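(* Assume that $r_{21}=r_{31}=0$. Let $r_{12},r_{13}$ be non-negative integers such that $c_1n_1=r_{12}n_2+r_{13}n_3$ with $0<r_{13}<c_3$. Let $g=y^{\eta r_{12}+\epsilon c_2}$ and $h=y^{b/d}-x^{(b-a)/d}z^{a/d}$. Then $$I^*=(g,h)+(p_{\alpha,\beta}\mid(\alpha,\beta)\in A)+(q_{\gamma,\sigma}\mid(\gamma,\sigma)\in B).$$ Furthermore, \begin{enumerate} \item If $\beta_h>\epsilon$ then $I^*=(g)+(p_{\alpha,\beta}\mid(\alpha,\beta)\in A)+(q_{\gamma,\sigma}\mid(\gamma,\sigma)\in B)$. \item If $\beta_h\le\epsilon$ then $I^*=(h)+(p_{\alpha,\beta}\mid(\alpha,\beta)\in A,\ \beta<\beta_h)+(q_{\gamma,\sigma}\mid(\gamma,\sigma)\in B)$. \item The minimal generators of $I^*$ form a Gr\"obner basis of $I^*$ with respect to the reverse lexicographic order. \item $\mu(I^* )\le c_3+2$. \end{enumerate}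
   Context: Let $K$ be a field and let $n_1<n_2<n_3$ be positive integers with $\gcd(n_1,n_2,n_3)=1$ that minimally generate the numerical semigroup $H=\langle n_1,n_2,n_3\rangle$. Let $S=K[x,y,z]$ with the standard grading, and let $I=I_H$ be the kernel of $S\to K[t]$, $x\mapsto t^{n_1}$, $y\mapsto t^{n_2}$, $z\mapsto t^{n_3}$. For nonzero $f\in S$, $f^*$ is its homogeneous component of smallest degree, and $I^*=(f^*\mid 0\neq f\in I)$; $\mu$ denotes the minimal number of generators. The reverse lexicographic order is the graded one with $x>y>z$. $\mathbb N$ contains $0$. Let $a=n_2-n_1$, $b=n_3-n_1$, $d=\gcd(a,b)$. Let $c_1,c_2,c_3$ be the smallest positive integers such that $c_1n_1\in\langle n_2,n_3\rangle$, $c_2n_2\in\langle n_1,n_3\rangle$, $c_3n_3\in\langle n_1,n_2\rangle$, and let $r_{ij}$ be non-negative integers with $c_1n_1=r_{12}n_2+r_{13}n_3$, $c_2n_2=r_{21}n_1+r_{23}n_3$, $c_3n_3=r_{31}n_1+r_{32}n_2$. When $r_{21}=r_{31}=0$ one has $c_2n_2=c_3n_3$. Put $\delta_1=c_1-(r_{12}+r_{13})$ and $\delta_2=c_2-c_3$ (both positive). Let $\alpha_h,\beta_h$ be the positive integers determined by $\alpha_hc_1=(b-a)/d$, $\alpha_hr_{12}+\beta_hc_2=b/d$, $-\alpha_hr_{13}+\beta_hc_3=a/d$. For a real number $r\geq 0$ define $\varphi_r:\mathbb N\to\mathbb N$ by $\varphi_r(t)=rt+1$ if $rt\in\mathbb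 N$ and $\varphi_r(t)=\lceil rt\rceil$ otherwise. One has $\frac{\delta_2}{\delta_1}<\frac{c_3}{r_{13}}$. Let $\epsilon$ be the smallest positive integer for which there is an integer $e$ with $\frac{\delta_2}{\delta_1}<\frac{e}{\epsilon}\le\frac{c_3}{r_{13}}$, and let $\eta$ be the smallest such $e$. Set $A$: let $\alpha_0=1,\beta_0=0$. For $i\ge0$, consider the system in $(\alpha,\beta)\in\mathbb N^2$: $\alpha r_{13}-\beta c_3>0$, $\ \alpha r_{13}-\beta c_3<\alpha_ir_{13}-\beta_ic_3$, $\ \beta>\beta_i$. If it has solutions, let $\beta_{i+1}$ be the smallest value of $\beta$ among its solutions and $\alpha_{i+1}=\varphi_{c_3/r_{13}}(\beta_{i+1})$; otherwise the sequence stops (it is always finite). Let $t$ be the largest index with $\beta_t<\epsilon$ and $A=\{(\alpha_i,\beta_i)\mid i=0,\ldots,t\}$. For $\alpha,\beta\in\mathbb N$ with $\alpha r_{13}-\beta c_3\ge0$, let $p_{\alpha,\beta}=y^{\alpha r_{12}+\beta c_2}z^{\alpha r_{13}-\beta c_3}$. Set $B$: let $\gamma_0=0,\sigma_0=1$. For $i\ge0$, consider the system in $(\gamma,\sigma)\in\mathbb N^2$: $-\gamma\delta_1+\sigma\delta_2>0$, $\ -\gamma r_{13}+\sigma c_3<-\gamma_ir_{13}+\sigma_ic_3$, $\ \gamma>\gamma_i$. If it has solutions, let $\gamma_{i+1}$ be the smallest value of $\gamma$ among its solutions and $\sigma_{i+1}=\varphi_{\delta_1/\delta_2}(\gamma_{i+1})$;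 otherwise the sequence stops (it is always finite). Let $u$ be the largest index and $B=\{(\gamma_i,\sigma_i)\mid i=0,\ldots,u\}$. For $\gamma,\sigma\in\mathbb N$ with $-\gamma\delta_1+\sigma\delta_2>0$, let $q_{\gamma,\sigma}=x^{\gamma c_1}z^{-\gamma r_{13}+\sigma c_3}$. *)

theory Defs
  imports
    "HOL-Library.Poly_Mapping"
    "HOL-Library.Product_Plus"
    "HOL-Computational_Algebra.Polynomial"
begin

section \<open>Polynomials in three variables\<close>

text \<open>
  The exponent \<^term>\<open>(i, j, k)\<close> stands for the monomial \<open>x^i y^j z^k\<close>; the ring \<open>K[x,y,z]\<close> is the
  monoid algebra of finitely supported functions on exponents.
\<close>

type_synonym mon = "nat \<times> nat \<times> nat"
type_synonym 'k pol3 = "mon \<Rightarrow>\<^sub>0 'k"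

definition X :: "'k::field pol3" where "X = Poly_Mapping.single (1, 0, 0) 1"
definition Y :: "'k::field pol3" where "Y = Poly_Mapping.single (0, 1, 0) 1"
definition Z :: "'k::field pol3" where "Z = Poly_Mapping.single (0, 0, 1) 1"

fun mon_deg :: "mon \<Rightarrow> nat" where
  "mon_deg (i, j, k) = i + j + k"

lemma module_times: "module ((*) :: 'a::comm_ring_1 \<Rightarrow> 'a \<Rightarrow> 'a)"
  by unfold_locales (auto simp: algebra_simps)

definition ideal_gen :: "'a::comm_ring_1 set \<Rightarrow> 'a set" where
  "ideal_gen G = module.span (*) G"

text \<open>
  For a homogeneous ideal this also is the least number of homogeneous generators, and irredundant
  homogeneous generating sets have this cardinality.
\<close>

definition mingen_number :: "'a::comm_ring_1 set \<Rightarrow> nat" where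
  "mingen_number I = (LEAST n. \<exists>G. finite G \<and> card G = n \<and> ideal_gen G = I)"

definition minimal_generating_set :: "'a::comm_ring_1 set \<Rightarrow> 'a set \<Rightarrow> bool" where
  "minimal_generating_set M I \<longleftrightarrow> ideal_gen M = I \<and> (\<forall>N. N \<subset> M \<longrightarrow> ideal_gen N \<noteq> I)"

subsection \<open>Initial forms\<close>

definition hom_component :: "nat \<Rightarrow> 'k::field pol3 \<Rightarrow> 'k pol3" where
  "hom_component e f =
     (\<Sum>m \<in> {m \<in> Poly_Mapping.keys f. mon_deg m = e}.
        Poly_Mapping.single m (Poly_Mapping.lookup f m))"

definition initial_form :: "'k::field pol3 \<Rightarrow> 'k pol3" where
  "initial_form f = hom_component (Min (mon_deg ` Poly_Mapping.keys f)) f"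

definition initial_form_ideal :: "'k::field pol3 set \<Rightarrow> 'k pol3 set" where
  "initial_form_ideal I = ideal_gen {initial_form f | f. f \<in> I \<and> f \<noteq> 0}"

subsection \<open>Groebner bases for the graded reverse lexicographic order with \<open>x > y > z\<close>\<close>

text \<open>
  In equal degree the monomial with the smaller exponent of \<open>z\<close> is the larger one, ties being broken
  by the exponent of \<open>y\<close> in the same way.
\<close>

fun revlex_less :: "mon \<Rightarrow> mon \<Rightarrow> bool" where
  "revlex_less (i, j, k) (i', j', k') \<longleftrightarrow>
     i + j + k < i' + j' + k' \<or>
     i + j + k = i' + j' + k' \<and> (k > k' \<or> k = k' \<and> j > j')"

definition lead_mon :: "'k::field pol3 \<Rightarrow> mon" where
  "lead_mon f = (THE m. m \<in> Poly_Mapping.keys f \<and>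
     (\<forall>m' \<in> Poly_Mapping.keys f. m' \<noteq> m \<longrightarrow> revlex_less m' m))"

definition lead_ideal :: "'k::field pol3 set \<Rightarrow> 'k pol3 set" where
  "lead_ideal F = ideal_gen {Poly_Mapping.single (lead_mon f) 1 | f. f \<in> F \<and> f \<noteq> 0}"

definition groebner_basis :: "'k::field pol3 set \<Rightarrow> 'k pol3 set \<Rightarrow> bool" where
  "groebner_basis G I \<longleftrightarrow> finite G \<and> 0 \<notin> G \<and> G \<subseteq> I \<and> lead_ideal G = lead_ideal I"

section \<open>Numerical semigroups\<close>

text \<open>Used only for finite sets of generators.\<close>

definition semigroup_gen :: "nat set \<Rightarrow> nat set" where
  "semigroup_gen N = {\<Sum>n\<in>N. u n * n | u :: nat \<Rightarrow> nat. True}"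

definition minimally_generates :: "nat set \<Rightarrow> nat set \<Rightarrow> bool" where
  "minimally_generates N H \<longleftrightarrow> semigroup_gen N = H \<and> (\<forall>N'. N' \<subset> N \<longrightarrow> semigroup_gen N' \<noteq> H)"

definition least_multiplier :: "nat \<Rightarrow> nat set \<Rightarrow> nat" where
  "least_multiplier n N = (LEAST c. 0 < c \<and> c * n \<in> semigroup_gen N)"

text \<open>The image of \<open>f\<close> under \<open>x \<mapsto> t^n1\<close>, \<open>y \<mapsto> t^n2\<close>, \<open>z \<mapsto> t^n3\<close>.\<close>

definition param_map :: "nat \<Rightarrow> nat \<Rightarrow> nat \<Rightarrow> 'k::field pol3 \<Rightarrow> 'k poly" where
  "param_map n1 n2 n3 f =
     (\<Sum>(i, j, k) \<in> Poly_Mapping.keys f.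
        smult (Poly_Mapping.lookup f (i, j, k)) (monom 1 n1 ^ i * monom 1 n2 ^ j * monom 1 n3 ^ k))"

definition semigroup_ideal :: "nat \<Rightarrow> nat \<Rightarrow> nat \<Rightarrow> 'k::field pol3 set" where
  "semigroup_ideal n1 n2 n3 = {f. param_map n1 n2 n3 f = 0}"

section \<open>The numerical data\<close>

definition h_pair :: "nat \<Rightarrow> nat \<Rightarrow> nat \<Rightarrow> nat \<Rightarrow> nat \<Rightarrow> nat \<Rightarrow> nat \<Rightarrow> nat \<times> nat" where
  "h_pair c1 c2 c3 r12 r13 a b =
     (let d = gcd a b in
      THE (\<alpha>, \<beta>). 0 < \<alpha> \<and> 0 < \<beta> \<and>
        \<alpha> * c1 = (b - a) div d \<and>
        \<alpha> * r12 + \<beta> * c2 = b div d \<and>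
        - int \<alpha> * int r13 + int \<beta> * int c3 = int (a div d))"

definition phi :: "real \<Rightarrow> nat \<Rightarrow> nat" where
  "phi r t = (if r * real t \<in> \<nat> then nat \<lfloor>r * real t\<rfloor> + 1 else nat \<lceil>r * real t\<rceil>)"

definition fraction_ok :: "int \<Rightarrow> int \<Rightarrow> nat \<Rightarrow> nat \<Rightarrow> nat \<Rightarrow> int \<Rightarrow> bool" where
  "fraction_ok \<delta>1 \<delta>2 r13 c3 \<epsilon> e \<longleftrightarrow>
     real_of_int \<delta>2 / real_of_int \<delta>1 < real_of_int e / real \<epsilon> \<and>
     real_of_int e / real \<epsilon> \<le> real c3 / real r13"

definition epsilon :: "int \<Rightarrow> int \<Rightarrow> nat \<Rightarrow> nat \<Rightarrow> nat" where
  "epsilon \<delta>1 \<delta>2 r13 c3 = (LEAST \<epsilon>. 0 < \<epsilon> \<and> (\<exists>e. fraction_ok \<delta>1 \<delta>2 r13 c3 \<epsilon> e))"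

text \<open>The least \<open>e\<close> is positive, because \<open>\<delta>2 / \<delta>1 > 0\<close>.\<close>

definition eta :: "int \<Rightarrow> int \<Rightarrow> nat \<Rightarrow> nat \<Rightarrow> int" where
  "eta \<delta>1 \<delta>2 r13 c3 = (LEAST e. fraction_ok \<delta>1 \<delta>2 r13 c3 (epsilon \<delta>1 \<delta>2 r13 c3) e)"

subsection \<open>The set \<open>A\<close>\<close>

text \<open>In both sequences the value \<^const>\<open>None\<close> means that the sequence has already stopped.\<close>

definition A_sys :: "nat \<Rightarrow> nat \<Rightarrow> nat \<times> nat \<Rightarrow> nat \<Rightarrow> nat \<Rightarrow> bool" where
  "A_sys r13 c3 prev \<alpha> \<beta> \<longleftrightarrow> (case prev of (\<alpha>\<^sub>i, \<beta>\<^sub>i) \<Rightarrow>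
     int \<alpha> * int r13 - int \<beta> * int c3 > 0 \<and>
     int \<alpha> * int r13 - int \<beta> * int c3 < int \<alpha>\<^sub>i * int r13 - int \<beta>\<^sub>i * int c3 \<and>
     \<beta> > \<beta>\<^sub>i)"

fun A_seq :: "nat \<Rightarrow> nat \<Rightarrow> nat \<Rightarrow> (nat \<times> nat) option" where
  "A_seq r13 c3 0 = Some (1, 0)"
| "A_seq r13 c3 (Suc i) = (case A_seq r13 c3 i of
      None \<Rightarrow> None
    | Some prev \<Rightarrow>
        if \<exists>\<alpha> \<beta>. A_sys r13 c3 prev \<alpha> \<beta>
        then let \<beta>' = (LEAST \<beta>. \<exists>\<alpha>. A_sys r13 c3 prev \<alpha> \<beta>)
             in Some (phi (real c3 / real r13) \<beta>', \<beta>')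
        else None)"

definition A_last :: "nat \<Rightarrow> nat \<Rightarrow> nat \<Rightarrow> nat" where
  "A_last r13 c3 \<epsilon> = (GREATEST i. \<exists>\<alpha> \<beta>. A_seq r13 c3 i = Some (\<alpha>, \<beta>) \<and> \<beta> < \<epsilon>)"

definition A_set :: "nat \<Rightarrow> nat \<Rightarrow> nat \<Rightarrow> (nat \<times> nat) set" where
  "A_set r13 c3 \<epsilon> = {v. \<exists>i \<le> A_last r13 c3 \<epsilon>. A_seq r13 c3 i = Some v}"

text \<open>Only used when \<open>\<alpha> r13 - \<beta> c3 \<ge> 0\<close>, so that the truncated subtraction is harmless.\<close>

definition p_mon :: "nat \<Rightarrow> nat \<Rightarrow> nat \<Rightarrow> nat \<Rightarrow> nat \<times> nat \<Rightarrow> 'k::field pol3" where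
  "p_mon c2 c3 r12 r13 = (\<lambda>(\<alpha>, \<beta>). Y ^ (\<alpha> * r12 + \<beta> * c2) * Z ^ (\<alpha> * r13 - \<beta> * c3))"

subsection \<open>The set \<open>B\<close>\<close>

definition B_sys :: "int \<Rightarrow> int \<Rightarrow> nat \<Rightarrow> nat \<Rightarrow> nat \<times> nat \<Rightarrow> nat \<Rightarrow> nat \<Rightarrow> bool" where
  "B_sys \<delta>1 \<delta>2 r13 c3 prev \<gamma> \<sigma> \<longleftrightarrow> (case prev of (\<gamma>\<^sub>i, \<sigma>\<^sub>i) \<Rightarrow>
     - int \<gamma> * \<delta>1 + int \<sigma> * \<delta>2 > 0 \<and>
     - int \<gamma> * int r13 + int \<sigma> * int c3 < - int \<gamma>\<^sub>i * int r13 + int \<sigma>\<^sub>i * int c3 \<and>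
     \<gamma> > \<gamma>\<^sub>i)"

fun B_seq :: "int \<Rightarrow> int \<Rightarrow> nat \<Rightarrow> nat \<Rightarrow> nat \<Rightarrow> (nat \<times> nat) option" where
  "B_seq \<delta>1 \<delta>2 r13 c3 0 = Some (0, 1)"
| "B_seq \<delta>1 \<delta>2 r13 c3 (Suc i) = (case B_seq \<delta>1 \<delta>2 r13 c3 i of
      None \<Rightarrow> None
    | Some prev \<Rightarrow>
        if \<exists>\<gamma> \<sigma>. B_sys \<delta>1 \<delta>2 r13 c3 prev \<gamma> \<sigma>
        then let \<gamma>' = (LEAST \<gamma>. \<exists>\<sigma>. B_sys \<delta>1 \<delta>2 r13 c3 prev \<gamma> \<sigma>)
             in Some (\<gamma>', phi (real_of_int \<delta>1 / real_of_int \<delta>2) \<gamma>')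
        else None)"

definition B_set :: "int \<Rightarrow> int \<Rightarrow> nat \<Rightarrow> nat \<Rightarrow> (nat \<times> nat) set" where
  "B_set \<delta>1 \<delta>2 r13 c3 = {v. \<exists>i. B_seq \<delta>1 \<delta>2 r13 c3 i = Some v}"

text \<open>
  Only used when \<open>- \<gamma> \<delta>1 + \<sigma> \<delta>2 > 0\<close>. As \<open>\<delta>2 / \<delta>1 < c3 / r13\<close>, the exponent of \<open>z\<close> is then
  positive and the truncated subtraction is again harmless.
\<close>

definition q_mon :: "nat \<Rightarrow> nat \<Rightarrow> nat \<Rightarrow> nat \<times> nat \<Rightarrow> 'k::field pol3" where
  "q_mon c1 c3 r13 = (\<lambda>(\<gamma>, \<sigma>). X ^ (\<gamma> * c1) * Z ^ (\<sigma> * c3 - \<gamma> * r13))"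

end

theory Submission
  imports Defs
begin

text \<open>
  Call the weight of a monomial the degree in \<open>t\<close> of its image.  The ideal \<open>I\<close> is spanned by the
  differences of monomials of equal weight.  Hence a monomial whose degree is not maximal among the
  monomials of its weight is an initial form, and so is a difference of two monomials of equal weight
  and equal degree.  Nothing else occurs: \<open>I\<^sup>*\<close> consists of the polynomials whose coefficients
  add up to zero over each class of monomials of a given weight and its maximal degree
  (\<open>initial_form_ideal_semigroup_ideal\<close>).  This is true for every monomial curve in three-space, and
  it leaves a question about lattice points.

  If \<open>r21 = r31 = 0\<close>, then \<open>n2 = c1 c3\<close>, \<open>n3 = c1 c2\<close> and \<open>n1 = r12 c3 + r13 c2\<close>
  (\<open>gluing_structure\<close>), and the exponent differences of equal weight form the lattice with basis
  \<open>(c1, -r12, -r13)\<close>, \<open>(0, -c2, c3)\<close> (\<open>lattice_basis\<close>).  The vector with coordinates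
  \<open>(\<alpha>, \<beta>)\<close> changes the degree by \<open>\<alpha> \<delta>1 - \<beta> \<delta>2\<close>.  So a monomial is nonmaximal iff it is
  divisible by the negative part of a vector with \<open>\<alpha> \<delta>1 > \<beta> \<delta>2\<close>.  According to the signs of
  the coordinates these negative parts are \<open>y^(\<alpha> r12 + \<beta> c2) z^(max 0 (\<alpha> r13 - \<beta> c3))\<close>, or
  \<open>q\<close> at \<open>(\<gamma>, \<sigma>) = (-\<alpha>, -\<beta>)\<close>, or multiples of \<open>z^c3\<close> (\<open>nonmaximal_cases\<close>).  In the first family,
  \<open>g\<close> divides if \<open>\<beta> \<ge> \<epsilon>\<close>.  If \<open>\<beta> < \<epsilon>\<close>, the minimality of \<open>\<epsilon>\<close> makes the exponent of \<open>z\<close> positive,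
  and a monomial from \<open>A\<close> divides, because \<open>A\<close> lists the successive record minima of that exponent.
  The set \<open>B\<close> does the same for the \<open>q\<close>.  Finally, vectors of degree zero are multiples of the one
  of \<open>h\<close>, so the homogeneous differences are multiples of \<open>h\<close>.

  If \<open>\<beta>_h > \<epsilon>\<close>, then \<open>g\<close> divides the first term of \<open>h\<close>; both terms of \<open>h\<close> are then nonmaximal and \<open>h\<close>
  is redundant.  If \<open>\<beta>_h \<le> \<epsilon>\<close>, rewriting a monomial by \<open>h\<close> subtracts \<open>(\<alpha>_h, \<beta>_h)\<close> from
  \<open>(\<alpha>, \<beta>)\<close>, which removes \<open>g\<close> and all \<open>p\<close> with \<open>\<beta> \<ge> \<beta>_h\<close>.

  For the Groebner basis, a leading monomial of an element of \<open>I\<^sup>*\<close> either is nonmaximal or is the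
  larger one of two monomials of a class, and then the leading monomial \<open>y^(b/d)\<close> of \<open>h\<close> divides it.
  Every nonmaximal monomial is divisible by the leading monomial of an element of any generating
  subset: this needs an argument only if \<open>h\<close> is in the subset, and then rests on the fact that the
  trailing term of \<open>h\<close> divides no \<open>p\<close>, and divides a \<open>q\<close> only if a \<open>q\<close> with smaller \<open>\<gamma>\<close> divides it too
  (\<open>groebner_basis_generating_subset\<close>).

  For the bound, only the part of \<open>A\<close> with \<open>\<beta> < \<beta>_h\<close> counts.  The exponents of \<open>z\<close> lie between \<open>1\<close>
  and \<open>c3\<close>, they are distinct along \<open>A\<close> and along \<open>B\<close>, and at most one value occurs both in that part
  and in \<open>B\<close> (\<open>no_common_exponent_above\<close>).  So \<open>c3 + 1\<close> bounds the number of \<open>p\<close> and \<open>q\<close> that are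
  needed, and one of \<open>g\<close>, \<open>h\<close> completes them to a generating set.
\<close>

section \<open>Ideals of a monoid algebra\<close>

lemma ideal_gen_base: "f \<in> G \<Longrightarrow> f \<in> ideal_gen G"
  unfolding ideal_gen_def by (rule module.span_base[OF module_times])

lemma ideal_gen_superset: "G \<subseteq> ideal_gen G"
  using ideal_gen_base by blast

lemma ideal_gen_zero: "0 \<in> ideal_gen G"
  unfolding ideal_gen_def by (rule module.span_zero[OF module_times])

lemma ideal_gen_add: "f \<in> ideal_gen G \<Longrightarrow> f' \<in> ideal_gen G \<Longrightarrow> f + f' \<in> ideal_gen G"
  unfolding ideal_gen_def by (rule module.span_add[OF module_times])

lemma ideal_gen_diff: "f \<in> ideal_gen G \<Longrightarrow> f' \<in> ideal_gen G \<Longrightarrow> f - f' \<in> ideal_gen G"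
  unfolding ideal_gen_def by (rule module.span_diff[OF module_times])

lemma ideal_gen_times: "f \<in> ideal_gen G \<Longrightarrow> p * f \<in> ideal_gen G"
  unfolding ideal_gen_def by (rule module.span_scale[OF module_times])

lemma ideal_gen_subset:
  assumes "G \<subseteq> J" "0 \<in> J" "\<And>f f'. f \<in> J \<Longrightarrow> f' \<in> J \<Longrightarrow> f + f' \<in> J"
    and "\<And>p f. f \<in> J \<Longrightarrow> p * f \<in> J"
  shows "ideal_gen G \<subseteq> J"
  unfolding ideal_gen_def using assms
  by (intro module.span_minimal[OF module_times] module.subspaceI[OF module_times]) auto

lemma ideal_gen_least: "G \<subseteq> ideal_gen G' \<Longrightarrow> ideal_gen G \<subseteq> ideal_gen G'"
  by (rule ideal_gen_subset) (auto intro: ideal_gen_zero ideal_gen_add ideal_gen_times)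

lemma ideal_gen_mono: "G \<subseteq> G' \<Longrightarrow> ideal_gen G \<subseteq> ideal_gen G'"
  by (rule ideal_gen_least) (auto intro: ideal_gen_base)

text \<open>
  Cancellation never creates exponents: a monomial in the ideal is divisible by a term of some
  generator.
\<close>

lemma keys_ideal_gen:
  fixes G :: "('a::comm_monoid_add \<Rightarrow>\<^sub>0 'k::comm_ring_1) set"
  assumes "f \<in> ideal_gen G" "m \<in> Poly_Mapping.keys f"
  shows "\<exists>f'\<in>G. \<exists>k\<in>Poly_Mapping.keys f'. \<exists>l. m = l + k"
proof -
  let ?J = "{f. \<forall>m\<in>Poly_Mapping.keys f. \<exists>f'\<in>G. \<exists>k\<in>Poly_Mapping.keys f'. \<exists>l. m = l + k}"
  have "ideal_gen G \<subseteq> ?J"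
  proof (rule ideal_gen_subset)
    show "G \<subseteq> ?J" by clarsimp (metis add_0)
    show "0 \<in> ?J" by simp
    show "f + f' \<in> ?J" if "f \<in> ?J" "f' \<in> ?J" for f f'
      using that keys_add[of f f'] by auto
    show "p * f \<in> ?J" if f: "f \<in> ?J" for p f
    proof clarsimp
      fix m assume "m \<in> Poly_Mapping.keys (p * f)"
      then obtain a b where "m = a + b" "b \<in> Poly_Mapping.keys f"
        using keys_mult[of p f] by auto
      with f obtain f' k l where "f' \<in> G" "k \<in> Poly_Mapping.keys f'" "m = (a + l) + k"
        by (auto simp: add.assoc)
      then show "\<exists>f'\<in>G. \<exists>k\<in>Poly_Mapping.keys f'. \<exists>l. m = l + k" by blast
    qed
  qed
  with assms show ?thesis by auto
qed

abbreviation monomial :: "'a \<Rightarrow> 'a::comm_monoid_add \<Rightarrow>\<^sub>0 'k::comm_ring_1" where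
  "monomial m \<equiv> Poly_Mapping.single m 1"

lemma ideal_gen_monomial_add: "monomial k \<in> ideal_gen G \<Longrightarrow> monomial (l + k) \<in> ideal_gen G"
  using ideal_gen_times[of "monomial k" G "monomial l"] by (simp add: mult_single)

lemma monomial_eq: "X ^ i * Y ^ j * Z ^ k = (monomial (i, j, k) :: 'k::field pol3)"
proof -
  have "X ^ i = (monomial (i, 0, 0) :: 'k pol3)" for i
    by (induction i) (simp_all add: X_def mult_single zero_prod_def[symmetric])
  moreover have "Y ^ i = (monomial (0, i, 0) :: 'k pol3)" for i
    by (induction i) (simp_all add: Y_def mult_single zero_prod_def[symmetric])
  moreover have "Z ^ i = (monomial (0, 0, i) :: 'k pol3)" for i
    by (induction i) (simp_all add: Z_def mult_single zero_prod_def[symmetric])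
  ultimately show ?thesis by (simp add: mult_single)
qed

section \<open>Sums of coefficients over the fibres of a grading\<close>

definition fibre_sum :: "('a \<Rightarrow> 'b) \<Rightarrow> ('a \<Rightarrow>\<^sub>0 'k::comm_ring_1) \<Rightarrow> 'b \<Rightarrow> 'k" where
  "fibre_sum \<theta> f v = (\<Sum>m \<in> {m \<in> Poly_Mapping.keys f. \<theta> m = v}. Poly_Mapping.lookup f m)"

lemma fibre_sum_superset:
  assumes "finite S" "Poly_Mapping.keys f \<subseteq> S"
  shows "fibre_sum \<theta> f v = (\<Sum>m \<in> {m \<in> S. \<theta> m = v}. Poly_Mapping.lookup f m)"
  unfolding fibre_sum_def using assms
  by (intro sum.mono_neutral_left) (auto simp: in_keys_iff)

lemma fibre_sum_zero [simp]: "fibre_sum \<theta> 0 v = 0"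
  by (simp add: fibre_sum_def)

lemma fibre_sum_add: "fibre_sum \<theta> (f + f') v = fibre_sum \<theta> f v + fibre_sum \<theta> f' v"
proof -
  let ?S = "Poly_Mapping.keys f \<union> Poly_Mapping.keys f'"
  have "fibre_sum \<theta> f'' v = (\<Sum>m \<in> {m \<in> ?S. \<theta> m = v}. Poly_Mapping.lookup f'' m)"
    if "Poly_Mapping.keys f'' \<subseteq> ?S" for f''
    using that by (intro fibre_sum_superset) auto
  from this[of f] this[of f'] this[OF keys_add] show ?thesis
    by (simp add: lookup_add sum.distrib del: Un_iff)
qed

lemma fibre_sum_single: "fibre_sum \<theta> (Poly_Mapping.single m c) v = (if \<theta> m = v then c else 0)"
  by (simp add: fibre_sum_superset[of "{m}"] if_distrib conj_commute Collect_conv_if)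

lemma fibre_sum_diff: "fibre_sum \<theta> (f - f') v = fibre_sum \<theta> f v - fibre_sum \<theta> f' v"
  using fibre_sum_add[of \<theta> "f - f'" f' v] by (simp add: algebra_simps)

lemma update_eq_add_single:
  "a \<notin> Poly_Mapping.keys f \<Longrightarrow> Poly_Mapping.update a b f = f + Poly_Mapping.single a b"
  by (rule poly_mapping_eqI) (auto simp: lookup_update lookup_add lookup_single when_def in_keys_iff)

lemma fibre_sum_single_times:
  fixes \<theta> :: "'a::comm_monoid_add \<Rightarrow> 'b::cancel_comm_monoid_add"
  assumes "\<And>m m'. \<theta> (m + m') = \<theta> m + \<theta> m'"
  shows "fibre_sum \<theta> (Poly_Mapping.single k c * f) (\<theta> k + v) = c * fibre_sum \<theta> f v"
proof (induction f rule: update_induct)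
  case const
  show ?case by simp
next
  case (update f a b)
  then show ?case
    by (simp add: update_eq_add_single distrib_left fibre_sum_add fibre_sum_single mult_single assms)
qed

section \<open>The tangent cone of a monomial curve\<close>

fun weight :: "nat \<Rightarrow> nat \<Rightarrow> nat \<Rightarrow> mon \<Rightarrow> nat" where
  "weight n1 n2 n3 (i, j, k) = i * n1 + j * n2 + k * n3"

lemma weight_add: "weight n1 n2 n3 (m + m') = weight n1 n2 n3 m + weight n1 n2 n3 m'"
  by (cases m; cases m') (simp add: algebra_simps)

lemma mon_deg_add: "mon_deg (m + m') = mon_deg m + mon_deg m'"
  by (cases m; cases m') simp

lemma semigroup_ideal_iff:
  fixes f :: "'k::field pol3"
  shows "f \<in> semigroup_ideal n1 n2 n3 \<longleftrightarrow> (\<forall>w. fibre_sum (weight n1 n2 n3) f w = 0)"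
proof -
  have "monom 1 n1 ^ i * monom 1 n2 ^ j * monom 1 n3 ^ k = (monom 1 (weight n1 n2 n3 (i, j, k)) :: 'k poly)"
    for i j k
    by (simp add: monom_power mult_monom algebra_simps)
  then have "param_map n1 n2 n3 f =
      (\<Sum>m \<in> Poly_Mapping.keys f. monom (Poly_Mapping.lookup f m) (weight n1 n2 n3 m))"
    unfolding param_map_def by (intro sum.cong) (auto simp: smult_monom simp del: weight.simps)
  then have "coeff (param_map n1 n2 n3 f) w = fibre_sum (weight n1 n2 n3) f w" for w
    by (simp add: coeff_sum fibre_sum_def sum.If_cases Int_def)
  then show ?thesis by (simp add: semigroup_ideal_def poly_eq_iff)
qed

text \<open>
  Two monomials of the same grade have the same image and the same degree; their difference is
  therefore its own initial form.
\<close>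

definition grade :: "nat \<Rightarrow> nat \<Rightarrow> nat \<Rightarrow> mon \<Rightarrow> nat \<times> nat" where
  "grade n1 n2 n3 m = (weight n1 n2 n3 m, mon_deg m)"

definition nonmaximal :: "nat \<Rightarrow> nat \<Rightarrow> nat \<Rightarrow> mon \<Rightarrow> bool" where
  "nonmaximal n1 n2 n3 m \<longleftrightarrow>
     (\<exists>m'. weight n1 n2 n3 m' = weight n1 n2 n3 m \<and> mon_deg m < mon_deg m')"

text \<open>
  This is \<open>I\<^sup>*\<close>, described by linear conditions on the coefficients instead of generators.
\<close>

definition tangent_ideal :: "nat \<Rightarrow> nat \<Rightarrow> nat \<Rightarrow> 'k::field pol3 set" where
  "tangent_ideal n1 n2 n3 =
     {f. \<forall>m. \<not> nonmaximal n1 n2 n3 m \<longrightarrow> fibre_sum (grade n1 n2 n3) f (grade n1 n2 n3 m) = 0}"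

lemma grade_add: "grade n1 n2 n3 (m + m') = grade n1 n2 n3 m + grade n1 n2 n3 m'"
  by (simp add: grade_def weight_add mon_deg_add)

lemma nonmaximal_cong:
  "grade n1 n2 n3 m = grade n1 n2 n3 m' \<Longrightarrow> nonmaximal n1 n2 n3 m = nonmaximal n1 n2 n3 m'"
  by (simp add: grade_def nonmaximal_def)

lemma nonmaximal_add: "nonmaximal n1 n2 n3 m \<Longrightarrow> nonmaximal n1 n2 n3 (l + m)"
  unfolding nonmaximal_def by (metis add_strict_left_mono mon_deg_add weight_add)

lemma monomial_in_tangent_ideal: "nonmaximal n1 n2 n3 m \<Longrightarrow> monomial m \<in> tangent_ideal n1 n2 n3"
  by (auto simp: tangent_ideal_def fibre_sum_single dest: nonmaximal_cong)

lemma binomial_in_tangent_ideal: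
  "grade n1 n2 n3 m = grade n1 n2 n3 m' \<Longrightarrow> monomial m - monomial m' \<in> tangent_ideal n1 n2 n3"
  by (auto simp: tangent_ideal_def fibre_sum_diff fibre_sum_single)

lemma tangent_ideal_add:
  "f \<in> tangent_ideal n1 n2 n3 \<Longrightarrow> f' \<in> tangent_ideal n1 n2 n3 \<Longrightarrow> f + f' \<in> tangent_ideal n1 n2 n3"
  by (simp add: tangent_ideal_def fibre_sum_add)

text \<open>
  If the grade of \<open>m\<close> is that of \<open>k\<close> plus that of some \<open>m0\<close>, the sum over the class of \<open>m\<close> in the
  product is \<open>c\<close> times the sum over the class of \<open>m0\<close> in \<open>f\<close>, and \<open>m0\<close> is again of maximal degree;
  otherwise the product has no term in the class of \<open>m\<close>.
\<close>

lemma tangent_ideal_single_times: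
  assumes f: "f \<in> tangent_ideal n1 n2 n3"
  shows "Poly_Mapping.single k c * f \<in> tangent_ideal n1 n2 n3"
  unfolding tangent_ideal_def
proof (intro CollectI allI impI)
  fix m assume m: "\<not> nonmaximal n1 n2 n3 m"
  let ?\<theta> = "grade n1 n2 n3" and ?p = "Poly_Mapping.single k c * f"
  show "fibre_sum ?\<theta> ?p (?\<theta> m) = 0"
  proof (cases "\<exists>m0. ?\<theta> m = ?\<theta> k + ?\<theta> m0")
    case True
    then obtain m0 where m0: "?\<theta> m = ?\<theta> k + ?\<theta> m0" by blast
    then have "\<not> nonmaximal n1 n2 n3 m0"
      using m nonmaximal_add nonmaximal_cong grade_add by metis
    with f m0 show ?thesis
      by (simp add: fibre_sum_single_times grade_add tangent_ideal_def del: split_paired_All)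
  next
    case False
    have "Poly_Mapping.keys ?p \<subseteq> {k + b | b. True}"
      using keys_mult[of "Poly_Mapping.single k c" f] by (auto split: if_splits)
    then have "?\<theta> m' \<noteq> ?\<theta> m" if "m' \<in> Poly_Mapping.keys ?p" for m'
      using that False grade_add[of n1 n2 n3 k] by (smt (verit) mem_Collect_eq subsetD)
    then have "{m' \<in> Poly_Mapping.keys ?p. ?\<theta> m' = ?\<theta> m} = {}" by blast
    then show ?thesis unfolding fibre_sum_def by (simp only: sum.empty)
  qed
qed

lemma tangent_ideal_times:
  assumes f: "f \<in> tangent_ideal n1 n2 n3"
  shows "p * f \<in> tangent_ideal n1 n2 n3"
proof (induction p rule: update_induct)
  case const
  show ?case by (simp add: tangent_ideal_def)
next
  case (update p a b)
  then show ?case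
    by (simp add: update_eq_add_single distrib_right tangent_ideal_add tangent_ideal_single_times f)
qed

text \<open>The coefficients in the class of \<open>m\<close> add up to zero, so \<open>m\<close> cannot be alone in it.\<close>

lemma tangent_ideal_class_partner:
  assumes f: "f \<in> tangent_ideal n1 n2 n3" and max: "\<not> nonmaximal n1 n2 n3 m"
    and m: "m \<in> Poly_Mapping.keys f"
  obtains m' where "m' \<noteq> m" "m' \<in> Poly_Mapping.keys f" "grade n1 n2 n3 m' = grade n1 n2 n3 m"
proof -
  let ?K = "{m' \<in> Poly_Mapping.keys f. grade n1 n2 n3 m' = grade n1 n2 n3 m}"
  have "sum (Poly_Mapping.lookup f) ?K = 0"
    using f max by (simp add: tangent_ideal_def fibre_sum_def del: split_paired_All)
  then have "?K \<noteq> {m}" using m by (auto simp: in_keys_iff)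
  moreover have "m \<in> ?K" using m by blast
  ultimately show thesis
    using that
    by (smt (verit) mem_Collect_eq singleton_iff subsetI subset_antisym empty_subsetI insert_subset)
qed

text \<open>
  Any polynomial in the tangent ideal can be cancelled term by term: subtract a multiple of a
  nonmaximal monomial, or of a difference of two monomials of the same maximal class.  The support
  shrinks in each step.
\<close>

lemma tangent_ideal_subset:
  fixes f :: "'k::field pol3"
  assumes "f \<in> tangent_ideal n1 n2 n3"
    and nonmax: "\<And>m. nonmaximal n1 n2 n3 m \<Longrightarrow> monomial m \<in> ideal_gen G"
    and binom: "\<And>m m'. grade n1 n2 n3 m = grade n1 n2 n3 m' \<Longrightarrow> monomial m - monomial m' \<in> ideal_gen G"
  shows "f \<in> ideal_gen G"
  using assms(1)
proof (induction "card (Poly_Mapping.keys f)" arbitrary: f rule: less_induct)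
  case less
  let ?\<theta> = "grade n1 n2 n3"
  have scale: "Poly_Mapping.single 0 c * u \<in> tangent_ideal n1 n2 n3" if "u \<in> tangent_ideal n1 n2 n3"
    for c and u :: "'k pol3" using that by (rule tangent_ideal_single_times)
  have step: "f \<in> ideal_gen G"
    if u: "u \<in> ideal_gen G" "u \<in> tangent_ideal n1 n2 n3"
      and sub: "Poly_Mapping.keys u \<subseteq> Poly_Mapping.keys f"
      and m: "m \<in> Poly_Mapping.keys f" "Poly_Mapping.lookup u m = 1" for u m
  proof -
    define f' where "f' = f - Poly_Mapping.single 0 (Poly_Mapping.lookup f m) * u"
    have lookup': "Poly_Mapping.lookup (Poly_Mapping.single 0 c * u) k = c * Poly_Mapping.lookup u k"
      for c k
      by (simp add: mult_map_scale_conv_mult[symmetric] Poly_Mapping.map.rep_eq when_def)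
    have "f' = f + Poly_Mapping.single 0 (- Poly_Mapping.lookup f m) * u"
      by (simp add: f'_def single_uminus)
    then have T: "f' \<in> tangent_ideal n1 n2 n3"
      using less.prems scale[OF u(2)] by (simp add: tangent_ideal_add)
    have "Poly_Mapping.keys f' \<subseteq> Poly_Mapping.keys f - {m}"
      using sub m by (simp add: f'_def subset_iff in_keys_iff lookup_minus lookup' del: split_paired_All)
        (metis mult_zero_right mult.right_neutral)
    then have "card (Poly_Mapping.keys f') < card (Poly_Mapping.keys f)"
      using m(1) by (intro psubset_card_mono) auto
    from less.hyps[OF this T] have "f' + Poly_Mapping.single 0 (Poly_Mapping.lookup f m) * u \<in> ideal_gen G"
      by (intro ideal_gen_add ideal_gen_times u)
    then show ?thesis by (simp add: f'_def)
  qed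
  show ?case
  proof (cases "f = 0")
    case True
    then show ?thesis by (simp add: ideal_gen_zero)
  next
    case False
    then obtain m where m: "m \<in> Poly_Mapping.keys f"
      by (metis all_not_in_conv keys_eq_empty)
    show ?thesis
    proof (cases "nonmaximal n1 n2 n3 m")
      case True
      from nonmax[OF True] monomial_in_tangent_ideal[OF True] show ?thesis
        using m by (intro step[of "monomial m" m]) (auto simp: lookup_single)
    next
      case False
      from tangent_ideal_class_partner[OF less.prems False m]
      obtain m' where m': "m' \<noteq> m" "m' \<in> Poly_Mapping.keys f" "?\<theta> m = ?\<theta> m'" by metis
      from binom[OF m'(3)] binomial_in_tangent_ideal[OF m'(3)] show ?thesis
        using m m' by (intro step[of "monomial m - monomial m'" m])
          (auto simp: lookup_single lookup_minus in_keys_iff when_def split: if_splits)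
    qed
  qed
qed

lemma lookup_hom_component:
  "Poly_Mapping.lookup (hom_component e f) m = (if mon_deg m = e then Poly_Mapping.lookup f m else 0)"
proof -
  have "Poly_Mapping.lookup (hom_component e f) m =
      (\<Sum>m' \<in> {m' \<in> Poly_Mapping.keys f. mon_deg m' = e}.
         if m' = m then Poly_Mapping.lookup f m else 0)"
    unfolding hom_component_def lookup_sum by (intro sum.cong) (auto simp: lookup_single when_def)
  then show ?thesis by (auto simp: in_keys_iff)
qed

lemma keys_hom_component:
  "Poly_Mapping.keys (hom_component e f) = {m \<in> Poly_Mapping.keys f. mon_deg m = e}"
  by (simp add: set_eq_iff in_keys_iff lookup_hom_component del: split_paired_All)

text \<open>
  Consider a class of maximal degree for its weight, where that degree is the lowest one of \<open>f\<close>.  All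
  terms of \<open>f\<close> of this weight lie in the class: smaller degrees do not occur in \<open>f\<close>, larger ones do
  not occur for this weight.  So the sum over the class is a coefficient of the image of \<open>f\<close>.
\<close>

lemma initial_form_in_tangent_ideal:
  assumes f: "f \<in> semigroup_ideal n1 n2 n3"
  shows "initial_form f \<in> tangent_ideal n1 n2 n3"
  unfolding tangent_ideal_def
proof (intro CollectI allI impI)
  fix m assume m: "\<not> nonmaximal n1 n2 n3 m"
  define e where "e = Min (mon_deg ` Poly_Mapping.keys f)"
  have e: "e \<le> mon_deg k" if "k \<in> Poly_Mapping.keys f" for k
    using that by (simp add: e_def)
  have eq: "{k \<in> Poly_Mapping.keys (initial_form f). grade n1 n2 n3 k = grade n1 n2 n3 m} =
      {k \<in> Poly_Mapping.keys f. mon_deg k = e \<and> weight n1 n2 n3 k = weight n1 n2 n3 m \<and> mon_deg k = mon_deg m}"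
    by (auto simp: initial_form_def keys_hom_component grade_def e_def)
  show "fibre_sum (grade n1 n2 n3) (initial_form f) (grade n1 n2 n3 m) = 0"
  proof (cases "mon_deg m = e")
    case True
    have "{k \<in> Poly_Mapping.keys f. mon_deg k = e \<and> weight n1 n2 n3 k = weight n1 n2 n3 m \<and> mon_deg k = mon_deg m}
        = {k \<in> Poly_Mapping.keys f. weight n1 n2 n3 k = weight n1 n2 n3 m}"
      using m e True by (auto simp: nonmaximal_def) (metis le_neq_implies_less)+
    then have "fibre_sum (grade n1 n2 n3) (initial_form f) (grade n1 n2 n3 m)
        = (\<Sum>k \<in> {k \<in> Poly_Mapping.keys f. weight n1 n2 n3 k = weight n1 n2 n3 m}. Poly_Mapping.lookup (initial_form f) k)"
      unfolding fibre_sum_def eq by simp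
    also have "\<dots> = fibre_sum (weight n1 n2 n3) f (weight n1 n2 n3 m)"
      unfolding fibre_sum_def using m e True
      by (intro sum.cong) (auto simp: initial_form_def e_def[symmetric] lookup_hom_component nonmaximal_def,
          metis le_neq_implies_less)
    also have "\<dots> = 0" using f by (simp add: semigroup_ideal_iff)
    finally show ?thesis .
  next
    case False
    then have "{k \<in> Poly_Mapping.keys (initial_form f). grade n1 n2 n3 k = grade n1 n2 n3 m} = {}"
      unfolding eq by auto
    then show ?thesis unfolding fibre_sum_def by (simp only: sum.empty)
  qed
qed

lemma initial_form_binomial:
  assumes "mon_deg m < mon_deg m'"
  shows "initial_form (monomial m - monomial m' :: 'k::field pol3) = monomial m"
proof -
  have "m \<noteq> m'" using assms by auto
  then have "Poly_Mapping.keys (monomial m - monomial m' :: 'k pol3) = {m, m'}"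
    by (simp add: set_eq_iff in_keys_iff lookup_minus lookup_single when_def del: split_paired_All)
  then have "Min (mon_deg ` Poly_Mapping.keys (monomial m - monomial m' :: 'k pol3)) = mon_deg m"
    using assms by simp
  then show ?thesis
    using assms by (intro poly_mapping_eqI)
      (auto simp: initial_form_def lookup_hom_component lookup_minus lookup_single when_def)
qed

lemma initial_form_homogeneous_binomial:
  assumes "mon_deg m = mon_deg m'"
  shows "initial_form (monomial m - monomial m' :: 'k::field pol3) = monomial m - monomial m'"
proof (cases "m = m'")
  case True
  then show ?thesis by (simp add: initial_form_def hom_component_def)
next
  case False
  then have "Poly_Mapping.keys (monomial m - monomial m' :: 'k pol3) = {m, m'}"
    by (simp add: set_eq_iff in_keys_iff lookup_minus lookup_single when_def del: split_paired_All)
  then have "Min (mon_deg ` Poly_Mapping.keys (monomial m - monomial m' :: 'k pol3)) = mon_deg m"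
    using assms by simp
  then show ?thesis
    using assms by (intro poly_mapping_eqI)
      (auto simp: initial_form_def lookup_hom_component lookup_minus lookup_single when_def)
qed

theorem initial_form_ideal_semigroup_ideal:
  "initial_form_ideal (semigroup_ideal n1 n2 n3) = (tangent_ideal n1 n2 n3 :: 'k::field pol3 set)"
proof (intro equalityI subsetI)
  let ?I = "semigroup_ideal n1 n2 n3 :: 'k pol3 set"
  show "f \<in> tangent_ideal n1 n2 n3" if "f \<in> initial_form_ideal ?I" for f :: "'k pol3"
  proof -
    have "initial_form_ideal ?I \<subseteq> tangent_ideal n1 n2 n3"
      unfolding initial_form_ideal_def
      by (rule ideal_gen_subset)
        (auto intro: initial_form_in_tangent_ideal tangent_ideal_add tangent_ideal_times,
         simp add: tangent_ideal_def)
    with that show ?thesis by blast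
  qed
  have init: "initial_form (monomial m - monomial m') \<in> initial_form_ideal ?I"
    if w: "weight n1 n2 n3 m = weight n1 n2 n3 m'" and ne: "m \<noteq> m'" for m m'
  proof -
    have "monomial m - monomial m' \<in> ?I"
      using w by (simp add: semigroup_ideal_iff fibre_sum_diff fibre_sum_single)
    moreover have "monomial m - monomial m' \<noteq> (0 :: 'k pol3)"
      using ne by (metis eq_iff_diff_eq_0 inj_single keys_single the_elem_eq zero_neq_one)
    ultimately show ?thesis
      unfolding initial_form_ideal_def by (intro ideal_gen_base) blast
  qed
  show "f \<in> initial_form_ideal ?I" if "f \<in> tangent_ideal n1 n2 n3" for f :: "'k pol3"
    unfolding initial_form_ideal_def using that
  proof (rule tangent_ideal_subset, fold initial_form_ideal_def)
    fix m assume "nonmaximal n1 n2 n3 m"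
    then obtain m' where m': "weight n1 n2 n3 m' = weight n1 n2 n3 m" "mon_deg m < mon_deg m'"
      by (auto simp: nonmaximal_def)
    then show "monomial m \<in> initial_form_ideal ?I"
      using init[of m m'] by (auto simp: initial_form_binomial)
  next
    fix m m' assume g: "grade n1 n2 n3 m = grade n1 n2 n3 m'"
    show "monomial m - monomial m' \<in> initial_form_ideal ?I"
    proof (cases "m = m'")
      case True
      then show ?thesis by (simp add: initial_form_ideal_def ideal_gen_zero)
    next
      case False
      then show ?thesis
        using init[of m m'] g by (auto simp: grade_def initial_form_homogeneous_binomial)
    qed
  qed
qed

section \<open>Sequences of record minima over the lattice points of a cone\<close>

text \<open>
  Common form of the sequences behind \<open>A\<close> and \<open>B\<close>: the cone is \<open>p w < s u\<close>, the objective is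
  \<open>s u' - p w'\<close>, and each pair minimises the objective among all cone points with at most the same \<open>p\<close>.
\<close>

locale record_minima =
  fixes u w u' w' :: int
  assumes u_pos: "0 < u" and w_nonneg: "0 \<le> w" and u'_pos: "0 < u'"
begin

definition admissible :: "nat \<Rightarrow> nat \<Rightarrow> bool" where
  "admissible p s \<longleftrightarrow> int p * w < int s * u"

definition objective :: "nat \<Rightarrow> nat \<Rightarrow> int" where
  "objective p s = int s * u' - int p * w'"

definition next_sys :: "nat \<times> nat \<Rightarrow> nat \<Rightarrow> nat \<Rightarrow> bool" where
  "next_sys v p s \<longleftrightarrow>
     admissible p s \<and> objective p s < objective (fst v) (snd v) \<and> fst v < p"

fun minima :: "nat \<Rightarrow> (nat \<times> nat) option" where
  "minima 0 = Some (0, 1)"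
| "minima (Suc i) = (case minima i of
      None \<Rightarrow> None
    | Some v \<Rightarrow>
        if \<exists>p s. next_sys v p s
        then let p = (LEAST p. \<exists>s. next_sys v p s)
             in Some (p, phi (of_int w / of_int u) p)
        else None)"

declare minima.simps(2) [simp del]

text \<open>Both cases of \<^const>\<open>phi\<close> are the least integer strictly above a nonnegative real.\<close>

lemma admissible_iff: "admissible p s \<longleftrightarrow> phi (of_int w / of_int u) p \<le> s"
proof -
  define x :: real where "x = of_int w / of_int u * real p"
  have x0: "0 \<le> x" using u_pos w_nonneg by (simp add: x_def)
  have "phi (of_int w / of_int u) p = nat (\<lfloor>x\<rfloor> + 1)"
  proof (cases "x \<in> \<nat>")
    case True
    then show ?thesis using x0 unfolding phi_def x_def[symmetric] by (simp add: nat_add_distrib)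
  next
    case False
    then have "x \<notin> \<int>" using x0 by (auto elim!: Ints_cases simp: Nats_altdef2)
    then have "\<lceil>x\<rceil> = \<lfloor>x\<rfloor> + 1" by (metis Ints_of_int ceiling_altdef)
    then show ?thesis using False unfolding phi_def x_def[symmetric] by simp
  qed
  also have "nat (\<lfloor>x\<rfloor> + 1) \<le> s \<longleftrightarrow> \<lfloor>x\<rfloor> < int s" by linarith
  also have "\<dots> \<longleftrightarrow> x < of_int (int s)" by (rule floor_less_iff)
  also have "\<dots> \<longleftrightarrow> real_of_int (int p * w) < of_int (int s * u)"
    using u_pos by (simp add: x_def field_simps)
  also have "\<dots> \<longleftrightarrow> admissible p s" unfolding of_int_less_iff admissible_def ..
  finally show ?thesis ..
qed

lemma minima_Suc_iff:
  "minima (Suc i) = Some v' \<longleftrightarrow> (\<exists>v. minima i = Some v \<and> (\<exists>p s. next_sys v p s) \<and>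
     v' = (let p = (LEAST p. \<exists>s. next_sys v p s) in (p, phi (of_int w / of_int u) p)))"
  by (auto simp: minima.simps(2) Let_def split: option.splits)

lemma minima_step:
  assumes "minima i = Some v" "minima (Suc i) = Some (p, s)"
  shows "next_sys v p s" "s = phi (of_int w / of_int u) p" "\<And>p' s'. next_sys v p' s' \<Longrightarrow> p \<le> p'"
proof -
  from assms have ex: "\<exists>p s. next_sys v p s"
    and p: "p = (LEAST p. \<exists>s. next_sys v p s)" and s: "s = phi (of_int w / of_int u) p"
    by (auto simp: minima.simps(2) Let_def split: if_splits)
  from LeastI_ex[OF ex] p obtain s' where s': "next_sys v p s'" by auto
  then have "s \<le> s'" "admissible p s"
    using admissible_iff[of p s'] admissible_iff[of p s] s by (auto simp: next_sys_def)
  moreover have "objective p s \<le> objective p s'"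
    using \<open>s \<le> s'\<close> u'_pos by (simp add: objective_def)
  ultimately show "next_sys v p s" using s' by (simp add: next_sys_def)
  show "s = phi (of_int w / of_int u) p" by (fact s)
  show "p \<le> p'" if "next_sys v p' s'" for p' s'
    unfolding p using that by (intro Least_le) blast
qed

lemma minima_secondary: "minima i = Some (p, s) \<Longrightarrow> s = phi (of_int w / of_int u) p"
proof (cases i)
  case 0
  assume "minima i = Some (p, s)"
  with 0 show ?thesis by (simp add: phi_def)
next
  case (Suc j)
  assume "minima i = Some (p, s)"
  with Suc show ?thesis by (auto simp: minima_Suc_iff Let_def)
qed

lemma minima_admissible: "minima i = Some (p, s) \<Longrightarrow> admissible p s"
  using minima_secondary admissible_iff by simp

text \<open>
  By induction: a cone point with first coordinate strictly between two consecutive minima does not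
  improve on the earlier one, since the later one has the least first coordinate that does.
\<close>

lemma minima_optimal:
  assumes "minima i = Some (p, s)" "admissible p' s'" "p' \<le> p"
  shows "objective p s \<le> objective p' s'"
  using assms
proof (induction i arbitrary: p s)
  case 0
  then have "1 \<le> s'" by (simp add: admissible_def zero_less_mult_iff)
  with 0 u'_pos show ?case by (simp add: objective_def)
next
  case (Suc i)
  then obtain q t where v: "minima i = Some (q, t)" by (auto simp: minima_Suc_iff)
  note step = minima_step[OF v Suc.prems(1)]
  consider "p' = p" | "p' \<le> q" | "q < p'" "p' < p" using Suc.prems(3) by linarith
  then show ?case
  proof cases
    case 1
    then have "s \<le> s'" using Suc.prems(2) step(2) admissible_iff by simp
    with 1 u'_pos show ?thesis by (simp add: objective_def)
  next
    case 2
    from Suc.IH[OF v Suc.prems(2) 2] step(1) show ?thesis by (simp add: next_sys_def)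
  next
    case 3
    then have "\<not> next_sys (q, t) p' s'" using step(3)[of p' s'] by auto
    with 3 Suc.prems(2) step(1) show ?thesis by (auto simp: next_sys_def)
  qed
qed


lemma minima_strict:
  assumes "i < j" "minima i = Some (p, s)" "minima j = Some (p', s')"
  shows "p < p' \<and> objective p' s' < objective p s"
  using assms
proof (induction j arbitrary: p' s')
  case 0
  then show ?case by simp
next
  case (Suc j)
  then obtain q t where v: "minima j = Some (q, t)" by (auto simp: minima_Suc_iff)
  have step: "q < p' \<and> objective p' s' < objective q t"
    using minima_step(1)[OF v Suc.prems(3)] by (simp add: next_sys_def)
  show ?case
  proof (cases "i = j")
    case True
    with v Suc.prems(2) step show ?thesis by simp
  next
    case False
    with Suc.IH[OF _ Suc.prems(2) v] Suc.prems(1) step show ?thesis by auto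
  qed
qed

lemma minima_inj:
  assumes "minima i = Some (p, s)" "minima j = Some (p', s')" "objective p s = objective p' s'"
  shows "i = j"
proof (rule ccontr)
  assume "i \<noteq> j"
  then consider "i < j" | "j < i" by linarith
  then show False
  proof cases
    case 1
    from minima_strict[OF this assms(1,2)] assms(3) show False by linarith
  next
    case 2
    from minima_strict[OF this assms(2,1)] assms(3) show False by linarith
  qed
qed

lemma minima_index_le: "minima i = Some (p, s) \<Longrightarrow> i \<le> p"
proof (induction i arbitrary: p s)
  case (Suc i)
  then obtain q t where v: "minima i = Some (q, t)" by (auto simp: minima_Suc_iff)
  from Suc.IH[OF this] minima_strict[OF _ v Suc.prems] show ?case by simp
qed simp

text \<open>
  The last minimum whose first coordinate does not exceed \<open>p\<close> works: if the objective at \<open>(p, s)\<close>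
  were smaller, then \<open>(p, s)\<close> would solve the system for its successor.
\<close>

lemma minima_dominate:
  assumes "admissible p s"
  obtains i p' s' where "minima i = Some (p', s')" "p' \<le> p" "s' \<le> s" "objective p' s' \<le> objective p s"
proof -
  define Q where "Q i \<longleftrightarrow> (\<exists>p' s'. minima i = Some (p', s') \<and> p' \<le> p)" for i
  define top where "top = Greatest Q"
  have bound: "i \<le> p" if "Q i" for i
    using that minima_index_le le_trans unfolding Q_def by blast
  have "Q 0" by (simp add: Q_def)
  then have "Q top" unfolding top_def using bound by (rule GreatestI_nat)
  then obtain p' s' where m: "minima top = Some (p', s')" "p' \<le> p" unfolding Q_def by blast
  have "objective p' s' \<le> objective p s"
  proof (rule ccontr)
    assume less: "\<not> objective p' s' \<le> objective p s"
    have "p' < p" using minima_optimal[OF m(1) assms] less m(2) by (meson leI)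
    then have sys: "next_sys (p', s') p s" using less assms by (simp add: next_sys_def)
    then have "\<exists>p s. next_sys (p', s') p s" by blast
    with m(1) obtain q t where n: "minima (Suc top) = Some (q, t)"
      by (simp add: minima.simps(2) Let_def)
    from minima_step(3)[OF m(1) n sys] have "Q (Suc top)" using n unfolding Q_def by blast
    then have "Suc top \<le> top" unfolding top_def using bound by (rule Greatest_le_nat)
    then show False by simp
  qed
  moreover have "s' \<le> s"
  proof -
    have "int p' * w \<le> int p * w" using m(2) w_nonneg by (simp add: mult_right_mono)
    then have "admissible p' s" using assms by (simp add: admissible_def)
    then show ?thesis using minima_secondary[OF m(1)] admissible_iff by simp
  qed
  ultimately show thesis using m that by blast
qed

definition all_minima :: "(nat \<times> nat) set" where
  "all_minima = {v. \<exists>i. minima i = Some v}"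

lemma inj_on_objective: "inj_on (\<lambda>(p, s). objective p s) all_minima"
proof (rule inj_onI, clarify)
  fix p s p' s'
  assume "(p, s) \<in> all_minima" "(p', s') \<in> all_minima" and eq: "objective p s = objective p' s'"
  then obtain i j where "minima i = Some (p, s)" "minima j = Some (p', s')" by (auto simp: all_minima_def)
  with minima_inj[OF this eq] show "p = p' \<and> s = s'" by simp
qed

lemma objective_le:
  assumes "(p, s) \<in> all_minima"
  shows "objective p s \<le> u'"
proof -
  from assms obtain i where i: "minima i = Some (p, s)" by (auto simp only: all_minima_def)
  have "admissible 0 1" using u_pos by (simp add: admissible_def)
  from minima_optimal[OF i this] show ?thesis by (simp add: objective_def)
qed

end

section \<open>Leading monomials\<close>

lemma revlex_less_irrefl: "\<not> revlex_less m m"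
  by (cases m) simp

lemma revlex_less_asym: "revlex_less m m' \<Longrightarrow> \<not> revlex_less m' m"
  by (cases m; cases m') auto

lemma revlex_less_trans: "revlex_less m m' \<Longrightarrow> revlex_less m' m'' \<Longrightarrow> revlex_less m m''"
  by (cases m; cases m'; cases m'') auto

lemma revlex_less_linear: "m \<noteq> m' \<Longrightarrow> revlex_less m m' \<or> revlex_less m' m"
  by (cases m; cases m') auto

lemma finite_revlex_greatest:
  "finite S \<Longrightarrow> S \<noteq> {} \<Longrightarrow> \<exists>m\<in>S. \<forall>m'\<in>S. m' \<noteq> m \<longrightarrow> revlex_less m' m"
proof (induction S rule: finite_ne_induct)
  case (singleton x)
  then show ?case by blast
next
  case (insert x S)
  then obtain m where m: "m \<in> S" "\<forall>m'\<in>S. m' \<noteq> m \<longrightarrow> revlex_less m' m" by blast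
  show ?case
  proof (cases "revlex_less x m")
    case True
    with m show ?thesis by blast
  next
    case False
    with insert.hyps m(1) have "revlex_less m x" using revlex_less_linear by metis
    with m have "\<forall>m'\<in>insert x S. m' \<noteq> x \<longrightarrow> revlex_less m' x"
      using revlex_less_trans by (metis insertE)
    then show ?thesis by blast
  qed
qed

lemma lead_mon_eqI:
  assumes "m \<in> Poly_Mapping.keys f"
    and "\<And>m'. m' \<in> Poly_Mapping.keys f \<Longrightarrow> m' \<noteq> m \<Longrightarrow> revlex_less m' m"
  shows "lead_mon f = m"
  unfolding lead_mon_def
proof (rule the_equality)
  show "m \<in> Poly_Mapping.keys f \<and> (\<forall>m'\<in>Poly_Mapping.keys f. m' \<noteq> m \<longrightarrow> revlex_less m' m)"
    using assms by blast
next
  fix k assume k: "k \<in> Poly_Mapping.keys f \<and> (\<forall>m'\<in>Poly_Mapping.keys f. m' \<noteq> k \<longrightarrow> revlex_less m' k)"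
  show "k = m"
  proof (rule ccontr)
    assume "k \<noteq> m"
    with assms(2)[of k] k assms(1) have "revlex_less k m" "revlex_less m k" by metis+
    then show False using revlex_less_asym by metis
  qed
qed

lemma lead_mon_greatest:
  assumes "f \<noteq> 0"
  shows "lead_mon f \<in> Poly_Mapping.keys f"
    and "m' \<in> Poly_Mapping.keys f \<Longrightarrow> m' \<noteq> lead_mon f \<Longrightarrow> revlex_less m' (lead_mon f)"
proof -
  have "Poly_Mapping.keys f \<noteq> {}" using assms by simp
  from finite_revlex_greatest[OF finite_keys this]
  obtain m where m: "m \<in> Poly_Mapping.keys f"
      "\<And>m'. m' \<in> Poly_Mapping.keys f \<Longrightarrow> m' \<noteq> m \<Longrightarrow> revlex_less m' m" by blast
  then have "lead_mon f = m" by (rule lead_mon_eqI)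
  with m(1) show "lead_mon f \<in> Poly_Mapping.keys f" by simp
  show "m' \<in> Poly_Mapping.keys f \<Longrightarrow> m' \<noteq> lead_mon f \<Longrightarrow> revlex_less m' (lead_mon f)"
    unfolding \<open>lead_mon f = m\<close> by (rule m(2))
qed

lemma lead_mon_monomial: "lead_mon (monomial m :: 'k::field pol3) = m"
  by (rule lead_mon_eqI) auto

lemma lead_mon_binomial:
  assumes "revlex_less m' m"
  shows "lead_mon (monomial m - monomial m' :: 'k::field pol3) = m"
proof -
  have "m \<noteq> m'" using assms revlex_less_irrefl by metis
  then have "Poly_Mapping.keys (monomial m - monomial m' :: 'k pol3) = {m, m'}"
    by (simp add: set_eq_iff in_keys_iff lookup_minus lookup_single when_def del: split_paired_All)
  then show ?thesis using assms by (intro lead_mon_eqI) auto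
qed

text \<open>
  The converse inclusion of leading ideals is automatic, so a Groebner basis is recognised by
  divisibility of leading monomials.
\<close>

lemma groebner_basisI:
  fixes M J :: "'k::field pol3 set"
  assumes "finite M" "0 \<notin> M" "M \<subseteq> J"
    and "\<And>f. f \<in> J \<Longrightarrow> f \<noteq> 0 \<Longrightarrow> \<exists>f'\<in>M. \<exists>l. lead_mon f = l + lead_mon f'"
  shows "groebner_basis M J"
proof -
  have "lead_ideal J \<subseteq> lead_ideal M"
    unfolding lead_ideal_def
  proof (rule ideal_gen_least, clarify)
    fix f assume "f \<in> J" "f \<noteq> 0"
    with assms(4) obtain f' l where f': "f' \<in> M" "lead_mon f = l + lead_mon f'" by blast
    with assms(2) have "monomial (lead_mon f') \<in> ideal_gen {monomial (lead_mon f) |f. f \<in> M \<and> f \<noteq> 0}"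
      by (intro ideal_gen_base) auto
    then show "monomial (lead_mon f) \<in> ideal_gen {monomial (lead_mon f) |f. f \<in> M \<and> f \<noteq> 0}"
      unfolding f'(2) by (rule ideal_gen_monomial_add)
  qed
  moreover have "lead_ideal M \<subseteq> lead_ideal J"
    unfolding lead_ideal_def using assms(3) by (intro ideal_gen_mono) auto
  ultimately show ?thesis using assms(1-3) by (simp add: groebner_basis_def)
qed

section \<open>The relation lattice\<close>

definition mdvd :: "mon \<Rightarrow> mon \<Rightarrow> bool" where
  "mdvd k m \<longleftrightarrow> (\<exists>l. m = l + k)"

lemma mdvd_iff [simp]: "mdvd (i, j, k) (i', j', k') \<longleftrightarrow> i \<le> i' \<and> j \<le> j' \<and> k \<le> k'"
proof
  assume "i \<le> i' \<and> j \<le> j' \<and> k \<le> k'"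
  then have "(i', j', k') = (i' - i, j' - j, k' - k) + (i, j, k)" by simp
  then show "mdvd (i, j, k) (i', j', k')" unfolding mdvd_def by blast
qed (auto simp: mdvd_def)

lemma mdvd_trans: "mdvd k m \<Longrightarrow> mdvd m m' \<Longrightarrow> mdvd k m'"
  unfolding mdvd_def by (metis add.assoc)

lemma monomial_mdvd: "monomial k \<in> ideal_gen G \<Longrightarrow> mdvd k m \<Longrightarrow> monomial m \<in> ideal_gen G"
  unfolding mdvd_def by (auto intro: ideal_gen_monomial_add)

lemma nonmaximal_mdvd: "nonmaximal n1 n2 n3 k \<Longrightarrow> mdvd k m \<Longrightarrow> nonmaximal n1 n2 n3 m"
  unfolding mdvd_def by (auto intro: nonmaximal_add)

locale gluing =
  fixes n1 n2 n3 c1 c2 c3 r12 r13 :: nat and \<delta>1 \<delta>2 :: int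
  assumes c1_pos: "0 < c1" and c3_less_c2: "c3 < c2" and coprime_c: "coprime c2 c3"
    and r13_pos: "0 < r13" and r13_less: "r13 < c3"
    and n1_eq: "n1 = r12 * c3 + r13 * c2" and n2_eq: "n2 = c1 * c3" and n3_eq: "n3 = c1 * c2"
    and n1_less_n2: "n1 < n2" and coprime_n1: "coprime n1 c1"
    and \<delta>1_eq: "\<delta>1 = int c1 - (int r12 + int r13)" and \<delta>2_eq: "\<delta>2 = int c2 - int c3"
begin

lemma \<delta>2_pos: "0 < \<delta>2"
  using c3_less_c2 by (simp add: \<delta>2_eq)

text \<open>
  This is \<open>n1 < n2\<close> in disguise.  Geometrically: in the first quadrant of the coordinates
  \<open>(\<alpha>, \<beta>)\<close>, a lattice vector that decreases the exponent of \<open>z\<close> increases the degree.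
\<close>

lemma slope_less: "int r13 * \<delta>2 < int c3 * \<delta>1"
proof -
  have "int (r12 * c3 + r13 * c2) < int (c1 * c3)"
    using n1_less_n2 unfolding n1_eq n2_eq by (simp only: of_nat_less_iff)
  then show ?thesis by (simp add: \<delta>1_eq \<delta>2_eq algebra_simps)
qed

lemma \<delta>1_pos: "0 < \<delta>1"
proof -
  have "0 < int c3 * \<delta>1"
    using slope_less \<delta>2_pos r13_pos by (meson less_trans of_nat_0_less_iff zero_less_mult_iff)
  then show ?thesis by (simp add: zero_less_mult_iff)
qed

text \<open>
  Hence the truncated subtraction in the exponent of \<open>z\<close> of a monomial \<open>q\<close> does not truncate.
\<close>

lemma cone_z_pos:
  assumes "int \<gamma> * \<delta>1 \<le> int \<sigma> * \<delta>2" "0 < \<sigma>"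
  shows "\<gamma> * r13 < \<sigma> * c3"
proof -
  have "int \<gamma> * int r13 * \<delta>1 = int r13 * (int \<gamma> * \<delta>1)" by (simp add: ac_simps)
  also have "\<dots> \<le> int r13 * (int \<sigma> * \<delta>2)" using assms(1) by (intro mult_left_mono) auto
  also have "\<dots> = int \<sigma> * (int r13 * \<delta>2)" by (simp add: ac_simps)
  also have "\<dots> < int \<sigma> * (int c3 * \<delta>1)" using slope_less assms(2) by simp
  finally have "int \<gamma> * int r13 * \<delta>1 < int \<sigma> * int c3 * \<delta>1" by (simp add: ac_simps)
  then have "int \<gamma> * int r13 < int \<sigma> * int c3" using \<delta>1_pos by simp
  then show ?thesis by (simp flip: of_nat_mult)
qed

text \<open>
  Reducing modulo \<open>c1\<close>, which divides \<open>n2\<close> and \<open>n3\<close> and is coprime to \<open>n1\<close>, gives the coordinate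
  \<open>\<alpha>\<close>; what remains is a relation between \<open>c3\<close> and \<open>c2\<close>, which gives \<open>\<beta>\<close> by coprimality.
\<close>

lemma lattice_basis:
  assumes "weight n1 n2 n3 (i', j', k') = weight n1 n2 n3 (i, j, k)"
  obtains \<alpha> \<beta> :: int where
    "int i' = int i + \<alpha> * int c1"
    "int j' = int j - \<alpha> * int r12 - \<beta> * int c2"
    "int k' = int k - \<alpha> * int r13 + \<beta> * int c3"
    "int (mon_deg (i', j', k')) - int (mon_deg (i, j, k)) = \<alpha> * \<delta>1 - \<beta> * \<delta>2"
proof -
  have eq: "(int i' - int i) * int n1 + (int j' - int j) * int n2 + (int k' - int k) * int n3 = 0"
    using arg_cong[OF assms, of int] by (simp add: algebra_simps)
  then have "(int i' - int i) * int n1 = int c1 * (- (int j' - int j) * int c3 - (int k' - int k) * int c2)"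
    by (simp add: n2_eq n3_eq algebra_simps)
  then have "int c1 dvd (int i' - int i) * int n1" by simp
  then have "int c1 dvd int i' - int i"
    using coprime_n1 by (simp add: coprime_dvd_mult_left_iff coprime_commute)
  then obtain \<alpha> where \<alpha>: "int i' - int i = int c1 * \<alpha>" by (auto elim: dvdE)
  have "int c1 * (\<alpha> * int n1 + (int j' - int j) * int c3 + (int k' - int k) * int c2) = 0"
    using eq unfolding \<alpha> n2_eq n3_eq by (simp add: algebra_simps)
  then have eq': "\<alpha> * int n1 + (int j' - int j) * int c3 + (int k' - int k) * int c2 = 0"
    using c1_pos by simp
  then have eq'': "(int j' - int j + \<alpha> * int r12) * int c3 = - int c2 * (int k' - int k + \<alpha> * int r13)"
    by (simp add: n1_eq algebra_simps)
  then have "int c2 dvd (int j' - int j + \<alpha> * int r12) * int c3" by simp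
  then have "int c2 dvd int j' - int j + \<alpha> * int r12"
    using coprime_c by (simp add: coprime_dvd_mult_left_iff)
  then obtain \<beta>' where "int j' - int j + \<alpha> * int r12 = int c2 * \<beta>'" by (auto elim: dvdE)
  then obtain \<beta> where \<beta>: "int j' - int j + \<alpha> * int r12 = - int c2 * \<beta>"
    by (metis minus_mult_minus minus_minus)
  have "int c2 * (int k' - int k + \<alpha> * int r13) = int c2 * (\<beta> * int c3)"
    using eq'' unfolding \<beta> by (simp add: algebra_simps)
  then have k: "int k' - int k + \<alpha> * int r13 = \<beta> * int c3"
    using c3_less_c2 by simp
  show thesis
  proof (rule that)
    show "int i' = int i + \<alpha> * int c1" using \<alpha> by (simp add: algebra_simps)
    show "int j' = int j - \<alpha> * int r12 - \<beta> * int c2" using \<beta> by (simp add: algebra_simps)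
    show "int k' = int k - \<alpha> * int r13 + \<beta> * int c3" using k by (simp add: algebra_simps)
    show "int (mon_deg (i', j', k')) - int (mon_deg (i, j, k)) = \<alpha> * \<delta>1 - \<beta> * \<delta>2"
      using \<alpha> \<beta> k by (simp add: \<delta>1_eq \<delta>2_eq algebra_simps)
  qed
qed

text \<open>
  The truncated subtraction is intended: for \<open>\<alpha> r13 \<le> \<beta> c3\<close> this is the pure power of \<open>y\<close> that is
  the negative part of the lattice vector.  In particular \<open>g\<close> is the case \<open>(\<eta>, \<epsilon>)\<close>.
\<close>

definition p_exp :: "nat \<Rightarrow> nat \<Rightarrow> mon" where
  "p_exp \<alpha> \<beta> = (0, \<alpha> * r12 + \<beta> * c2, \<alpha> * r13 - \<beta> * c3)"

definition q_exp :: "nat \<Rightarrow> nat \<Rightarrow> mon" where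
  "q_exp \<gamma> \<sigma> = (\<gamma> * c1, 0, \<sigma> * c3 - \<gamma> * r13)"

lemma p_mon_eq: "p_mon c2 c3 r12 r13 (\<alpha>, \<beta>) = (monomial (p_exp \<alpha> \<beta>) :: 'k::field pol3)"
  unfolding p_mon_def p_exp_def using monomial_eq[where 'k='k, of 0] by simp

lemma q_mon_eq: "q_mon c1 c3 r13 (\<gamma>, \<sigma>) = (monomial (q_exp \<gamma> \<sigma>) :: 'k::field pol3)"
  unfolding q_mon_def q_exp_def using monomial_eq[where 'k='k, of _ 0] by simp

text \<open>
  The witness is the positive part of the lattice vector with coordinates \<open>(\<alpha>, \<beta>)\<close>.
\<close>

lemma nonmaximal_p_exp:
  assumes "int \<beta> * \<delta>2 < int \<alpha> * \<delta>1"
  shows "nonmaximal n1 n2 n3 (p_exp \<alpha> \<beta>)"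
  unfolding nonmaximal_def
proof (intro exI conjI)
  define z z' where "z = \<alpha> * r13 - \<beta> * c3" and "z' = \<beta> * c3 - \<alpha> * r13"
  have "int z - int z' = int (\<alpha> * r13) - int (\<beta> * c3)" unfolding z_def z'_def by linarith
  then have z: "int z' = int z - int \<alpha> * int r13 + int \<beta> * int c3" by simp
  let ?m' = "(\<alpha> * c1, 0, z')"
  have p: "p_exp \<alpha> \<beta> = (0, \<alpha> * r12 + \<beta> * c2, z)" by (simp add: p_exp_def z_def)
  have "int (weight n1 n2 n3 ?m') = int (weight n1 n2 n3 (p_exp \<alpha> \<beta>))"
    by (simp add: p z n1_eq n2_eq n3_eq algebra_simps)
  then show "weight n1 n2 n3 ?m' = weight n1 n2 n3 (p_exp \<alpha> \<beta>)" by (simp only: of_nat_eq_iff)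
  have "int (mon_deg ?m') - int (mon_deg (p_exp \<alpha> \<beta>)) = int \<alpha> * \<delta>1 - int \<beta> * \<delta>2"
    by (simp add: p z \<delta>1_eq \<delta>2_eq algebra_simps)
  with assms show "mon_deg (p_exp \<alpha> \<beta>) < mon_deg ?m'" by linarith
qed

text \<open>
  The witness is the positive part of the lattice vector with coordinates \<open>(-\<gamma>, -\<sigma>)\<close>.
\<close>

lemma nonmaximal_q_exp:
  assumes "int \<gamma> * \<delta>1 < int \<sigma> * \<delta>2"
  shows "nonmaximal n1 n2 n3 (q_exp \<gamma> \<sigma>)"
  unfolding nonmaximal_def
proof (intro exI conjI)
  let ?m' = "(0, \<gamma> * r12 + \<sigma> * c2, 0)"
  have "0 < \<sigma>" using assms \<delta>1_pos by (cases "\<sigma> = 0") (simp_all add: zero_less_mult_iff mult_less_0_iff)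
  then have le: "\<gamma> * r13 \<le> \<sigma> * c3" using cone_z_pos[of \<gamma> \<sigma>] assms by simp
  define z where "z = \<sigma> * c3 - \<gamma> * r13"
  have z: "int z = int \<sigma> * int c3 - int \<gamma> * int r13" using le by (simp add: z_def of_nat_diff)
  have q: "q_exp \<gamma> \<sigma> = (\<gamma> * c1, 0, z)" by (simp add: q_exp_def z_def)
  have "int (weight n1 n2 n3 ?m') = int (weight n1 n2 n3 (q_exp \<gamma> \<sigma>))"
    by (simp add: q z n1_eq n2_eq n3_eq algebra_simps)
  then show "weight n1 n2 n3 ?m' = weight n1 n2 n3 (q_exp \<gamma> \<sigma>)" by (simp only: of_nat_eq_iff)
  have "int (mon_deg ?m') - int (mon_deg (q_exp \<gamma> \<sigma>)) = int \<sigma> * \<delta>2 - int \<gamma> * \<delta>1"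
    by (simp add: q z \<delta>1_eq \<delta>2_eq algebra_simps)
  with assms show "mon_deg (q_exp \<gamma> \<sigma>) < mon_deg ?m'" by linarith
qed

text \<open>
  A monomial of the same weight and larger degree differs from \<open>m\<close> by a lattice vector; the negative
  part of that vector divides \<open>m\<close>, and the signs of its coordinates decide between the two families.
\<close>

lemma nonmaximal_cases:
  assumes "nonmaximal n1 n2 n3 m"
  obtains \<alpha> \<beta> where "int \<beta> * \<delta>2 < int \<alpha> * \<delta>1" "mdvd (p_exp \<alpha> \<beta>) m"
    | \<gamma> \<sigma> where "int \<gamma> * \<delta>1 < int \<sigma> * \<delta>2" "mdvd (q_exp \<gamma> \<sigma>) m"
proof -
  obtain i j k where m: "m = (i, j, k)" by (cases m)
  from assms obtain i' j' k' where w: "weight n1 n2 n3 (i', j', k') = weight n1 n2 n3 (i, j, k)"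
    and deg: "mon_deg (i, j, k) < mon_deg (i', j', k')"
    unfolding nonmaximal_def m by (metis prod_cases3)
  from lattice_basis[OF w] obtain \<alpha> \<beta> :: int where v:
    "int i' = int i + \<alpha> * int c1"
    "int j' = int j - \<alpha> * int r12 - \<beta> * int c2"
    "int k' = int k - \<alpha> * int r13 + \<beta> * int c3"
    "int (mon_deg (i', j', k')) - int (mon_deg (i, j, k)) = \<alpha> * \<delta>1 - \<beta> * \<delta>2" .
  have cone: "\<beta> * \<delta>2 < \<alpha> * \<delta>1" using v(4) deg by linarith
  consider (p) "0 \<le> \<alpha>" "0 \<le> \<beta>" | (q) "\<alpha> \<le> 0" "\<beta> < 0" | (z) "0 < \<alpha>" "\<beta> < 0"
  proof (cases "\<beta> < 0")
    case False
    then have "0 \<le> \<beta> * \<delta>2" using \<delta>2_pos by simp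
    with cone have "0 < \<alpha> * \<delta>1" by linarith
    then have "0 < \<alpha>" using \<delta>1_pos by (simp add: zero_less_mult_iff)
    with False show ?thesis using that by auto
  qed (use that in force)
  then show thesis
  proof cases
    case p
    define x y where "x = nat \<alpha>" and "y = nat \<beta>"
    have xy: "\<alpha> = int x" "\<beta> = int y" using p by (simp_all add: x_def y_def)
    have "int (x * r12 + y * c2) \<le> int j" "int (x * r13) \<le> int k + int (y * c3)"
      using v(2,3) unfolding xy by simp_all
    then have "mdvd (p_exp x y) m" unfolding m p_exp_def mdvd_iff by linarith
    with cone xy show thesis using that(1) by simp
  next
    case q
    define x y where "x = nat (- \<alpha>)" and "y = nat (- \<beta>)"
    have xy: "\<alpha> = - int x" "\<beta> = - int y" using q by (simp_all add: x_def y_def)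
    have "int (x * c1) \<le> int i" "int (y * c3) \<le> int k + int (x * r13)"
      using v(1,3) unfolding xy by simp_all
    then have "mdvd (q_exp x y) m" unfolding m q_exp_def mdvd_iff by linarith
    moreover have "int x * \<delta>1 < int y * \<delta>2" using cone xy by simp
    ultimately show thesis using that(2) by blast
  next
    \<comment> \<open>Here \<open>z^c3\<close>, the \<open>q\<close> with \<open>(\<gamma>, \<sigma>) = (0, 1)\<close>, already divides.\<close>
    case z
    have "1 * int c3 \<le> - \<beta> * int c3" using z by (intro mult_right_mono) auto
    moreover have "0 \<le> \<alpha> * int r13" using z by simp
    ultimately have "int c3 \<le> int k" using v(3) by linarith
    then have "mdvd (q_exp 0 1) m" by (simp add: m q_exp_def)
    then show thesis using that(2)[of 0 1] \<delta>2_pos by simp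
  qed
qed

sublocale A: record_minima "int r13" "int c3" "int r13" "int c3"
  by unfold_locales (use r13_pos in auto)

sublocale B: record_minima \<delta>2 \<delta>1 "int c3" "int r13"
  by unfold_locales (use r13_less \<delta>1_pos \<delta>2_pos in auto)

text \<open>
  The pairs of \<open>A\<close> have the first coordinate of the record sequence in second place.
\<close>

lemma A_seq_eq: "A_seq r13 c3 i = map_option prod.swap (A.minima i)"
proof (induction i)
  case (Suc i)
  show ?case
  proof (cases "A.minima i")
    case (Some v)
    obtain p s where v: "v = (p, s)" by (cases v)
    have sys: "A_sys r13 c3 (s, p) \<alpha> \<beta> \<longleftrightarrow> A.next_sys v \<beta> \<alpha>" for \<alpha> \<beta>
      by (auto simp: A_sys_def A.next_sys_def v A.admissible_def A.objective_def)
    show ?thesis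
      using Some Suc.IH unfolding v by (simp add: A.minima.simps(2) sys[unfolded v] Let_def) blast
  qed (use Suc.IH in \<open>simp add: A.minima.simps(2)\<close>)
qed simp

lemma B_seq_eq: "B_seq \<delta>1 \<delta>2 r13 c3 i = B.minima i"
proof (induction i)
  case (Suc i)
  show ?case
  proof (cases "B.minima i")
    case (Some v)
    obtain p s where v: "v = (p, s)" by (cases v)
    have sys: "B_sys \<delta>1 \<delta>2 r13 c3 (p, s) = B.next_sys v"
      by (auto simp: fun_eq_iff B_sys_def B.next_sys_def v B.admissible_def B.objective_def)
    show ?thesis
      using Some Suc.IH unfolding v by (simp add: B.minima.simps(2) sys[unfolded v] Let_def)
  qed (use Suc.IH in \<open>simp add: B.minima.simps(2)\<close>)
qed simp

lemma B_set_eq: "B_set \<delta>1 \<delta>2 r13 c3 = B.all_minima"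
  by (simp add: B_set_def B.all_minima_def B_seq_eq)

lemma A_set_eq:
  assumes "0 < \<epsilon>"
  shows "A_set r13 c3 \<epsilon> = {(\<alpha>, \<beta>). (\<beta>, \<alpha>) \<in> A.all_minima \<and> \<beta> < \<epsilon>}"
proof -
  define R where "R i \<longleftrightarrow> (\<exists>\<alpha> \<beta>. A.minima i = Some (\<beta>, \<alpha>) \<and> \<beta> < \<epsilon>)" for i
  have swap: "A_seq r13 c3 i = Some (\<alpha>, \<beta>) \<longleftrightarrow> A.minima i = Some (\<beta>, \<alpha>)" for i \<alpha> \<beta>
    by (auto simp: A_seq_eq)
  have last: "A_last r13 c3 \<epsilon> = Greatest R" by (simp add: A_last_def swap R_def[abs_def])
  have bound: "i \<le> \<epsilon>" if "R i" for i
    using that A.minima_index_le unfolding R_def by (meson le_trans less_imp_le)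
  have "R 0" using assms by (simp add: R_def)
  then have "R (Greatest R)" using bound by (rule GreatestI_nat)
  then obtain \<alpha>' \<beta>' where l: "A.minima (Greatest R) = Some (\<beta>', \<alpha>')" "\<beta>' < \<epsilon>"
    unfolding R_def by blast
  have "i \<le> Greatest R \<longleftrightarrow> \<beta> < \<epsilon>" if m: "A.minima i = Some (\<beta>, \<alpha>)" for i \<alpha> \<beta>
  proof
    assume "i \<le> Greatest R"
    then consider "i = Greatest R" | "i < Greatest R" by linarith
    then show "\<beta> < \<epsilon>"
    proof cases
      case 1
      with m l show ?thesis by simp
    next
      case 2
      from A.minima_strict[OF this m l(1)] l(2) show ?thesis by simp
    qed
  next
    assume "\<beta> < \<epsilon>"
    with m have "R i" unfolding R_def by blast
    then show "i \<le> Greatest R" using bound by (rule Greatest_le_nat)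
  qed
  then have "(\<exists>i\<le>Greatest R. A.minima i = Some (\<beta>, \<alpha>)) \<longleftrightarrow> (\<exists>i. A.minima i = Some (\<beta>, \<alpha>)) \<and> \<beta> < \<epsilon>" for \<alpha> \<beta>
    by blast
  then show ?thesis
    unfolding A_set_def last A.all_minima_def by (simp add: set_eq_iff swap)
qed

end

section \<open>Generators of the tangent cone\<close>

text \<open>
  The assumptions on \<open>\<epsilon>\<close> and \<open>\<eta>\<close> are the defining inequalities of the two minima with denominators
  cleared.  The vector \<open>(\<alpha>h, \<beta>h)\<close> is primitive on the line where the degree does not change; together
  with positivity this determines it.
\<close>

locale gluing_tangent = gluing +
  fixes \<epsilon> \<eta> \<alpha>h \<beta>h :: nat
  assumes \<epsilon>_pos: "0 < \<epsilon>" and \<eta>_above: "int \<epsilon> * \<delta>2 < int \<eta> * \<delta>1" and \<eta>_below: "\<eta> * r13 \<le> \<epsilon> * c3"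
    and \<epsilon>_least: "\<And>\<alpha> \<beta>. 0 < \<beta> \<Longrightarrow> int \<beta> * \<delta>2 < int \<alpha> * \<delta>1 \<Longrightarrow> \<alpha> * r13 \<le> \<beta> * c3 \<Longrightarrow> \<epsilon> \<le> \<beta>"
    and \<eta>_least: "\<And>\<alpha>. int \<epsilon> * \<delta>2 < int \<alpha> * \<delta>1 \<Longrightarrow> \<eta> \<le> \<alpha>"
    and \<alpha>h_pos: "0 < \<alpha>h" and \<beta>h_pos: "0 < \<beta>h"
    and h_slope: "int \<alpha>h * \<delta>1 = int \<beta>h * \<delta>2" and h_coprime: "coprime \<alpha>h \<beta>h"
begin

text \<open>
  The exponents of \<open>g\<close> and of the two terms of \<open>h\<close>, where \<open>h\<close> is written in lattice coordinates.
\<close>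

definition g_exp :: mon where "g_exp = (0, \<eta> * r12 + \<epsilon> * c2, 0)"
definition y_exp :: mon where "y_exp = (0, \<alpha>h * r12 + \<beta>h * c2, 0)"
definition w_exp :: mon where "w_exp = (\<alpha>h * c1, 0, \<beta>h * c3 - \<alpha>h * r13)"

definition h_poly :: "'k::field pol3" where
  "h_poly = monomial y_exp - monomial w_exp"

abbreviation A_pairs :: "(nat \<times> nat) set" where
  "A_pairs \<equiv> A_set r13 c3 \<epsilon>"

abbreviation B_pairs :: "(nat \<times> nat) set" where
  "B_pairs \<equiv> B_set \<delta>1 \<delta>2 r13 c3"

abbreviation P_set :: "'k::field pol3 set" where
  "P_set \<equiv> p_mon c2 c3 r12 r13 ` A_pairs"

abbreviation P'_set :: "'k::field pol3 set" where
  "P'_set \<equiv> p_mon c2 c3 r12 r13 ` {(\<alpha>, \<beta>) \<in> A_pairs. \<beta> < \<beta>h}"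

abbreviation Q_set :: "'k::field pol3 set" where
  "Q_set \<equiv> q_mon c1 c3 r13 ` B_pairs"

lemma \<eta>_pos: "0 < \<eta>"
proof -
  have "0 < int \<eta> * \<delta>1" using \<eta>_above \<delta>2_pos by (meson le_less_trans mult_nonneg_nonneg of_nat_0_le_iff less_imp_le)
  then show ?thesis using \<delta>1_pos by (simp add: zero_less_mult_iff)
qed

lemma w_z_pos: "\<alpha>h * r13 < \<beta>h * c3"
  using h_slope \<beta>h_pos by (intro cone_z_pos) auto

lemma h_multiple:
  fixes \<alpha> \<beta> :: int
  assumes "\<alpha> * \<delta>1 = \<beta> * \<delta>2"
  obtains k where "\<alpha> = k * int \<alpha>h" "\<beta> = k * int \<beta>h"
proof -
  have "\<alpha> * int \<beta>h * \<delta>2 = \<alpha> * (int \<alpha>h * \<delta>1)" using h_slope by simp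
  also have "\<dots> = int \<alpha>h * \<beta> * \<delta>2" using assms by simp
  finally have eq: "\<alpha> * int \<beta>h = int \<alpha>h * \<beta>" using \<delta>2_pos by simp
  then have "int \<alpha>h dvd \<alpha> * int \<beta>h" by simp
  then have "int \<alpha>h dvd \<alpha>" using h_coprime by (simp add: coprime_dvd_mult_left_iff)
  then obtain k where k: "\<alpha> = int \<alpha>h * k" by (auto elim: dvdE)
  with eq \<alpha>h_pos have "\<beta> = k * int \<beta>h" by simp
  with k show thesis using that[of k] by simp
qed

lemma same_grade:
  assumes "grade n1 n2 n3 (i', j', z') = grade n1 n2 n3 (i, j, z)"
  obtains k :: int where
    "int i' = int i + k * int (\<alpha>h * c1)"
    "int j' = int j - k * int (\<alpha>h * r12 + \<beta>h * c2)"
    "int z' = int z + k * int (\<beta>h * c3 - \<alpha>h * r13)"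
proof -
  have w: "weight n1 n2 n3 (i', j', z') = weight n1 n2 n3 (i, j, z)"
    and d: "mon_deg (i', j', z') = mon_deg (i, j, z)"
    using assms unfolding grade_def by blast+
  from lattice_basis[OF w] obtain \<alpha> \<beta> :: int where v:
    "int i' = int i + \<alpha> * int c1"
    "int j' = int j - \<alpha> * int r12 - \<beta> * int c2"
    "int z' = int z - \<alpha> * int r13 + \<beta> * int c3"
    "int (mon_deg (i', j', z')) - int (mon_deg (i, j, z)) = \<alpha> * \<delta>1 - \<beta> * \<delta>2" .
  from v(4) d have "\<alpha> * \<delta>1 = \<beta> * \<delta>2" by simp
  then obtain k where k: "\<alpha> = k * int \<alpha>h" "\<beta> = k * int \<beta>h" by (rule h_multiple)
  show thesis
  proof (rule that[of k])
    show "int i' = int i + k * int (\<alpha>h * c1)" using v(1) by (simp add: k algebra_simps)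
    show "int j' = int j - k * int (\<alpha>h * r12 + \<beta>h * c2)" using v(2) by (simp add: k algebra_simps)
    show "int z' = int z + k * int (\<beta>h * c3 - \<alpha>h * r13)"
      using v(3) w_z_pos by (simp add: k algebra_simps of_nat_diff)
  qed
qed

lemma grade_y_exp: "grade n1 n2 n3 y_exp = grade n1 n2 n3 w_exp"
proof -
  define z where "z = \<beta>h * c3 - \<alpha>h * r13"
  have z: "int z = int \<beta>h * int c3 - int \<alpha>h * int r13" using w_z_pos by (simp add: z_def of_nat_diff)
  have w: "w_exp = (\<alpha>h * c1, 0, z)" by (simp add: w_exp_def z_def)
  have "int (weight n1 n2 n3 y_exp) = int (weight n1 n2 n3 w_exp)"
    by (simp add: y_exp_def w z n1_eq n2_eq n3_eq algebra_simps)
  moreover have "int (mon_deg y_exp) = int (mon_deg w_exp)"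
    using h_slope by (simp add: y_exp_def w z \<delta>1_eq \<delta>2_eq algebra_simps)
  ultimately show ?thesis unfolding grade_def of_nat_eq_iff by simp
qed

lemma h_poly_times:
  "monomial m * h_poly = (monomial (m + y_exp) - monomial (m + w_exp) :: 'k::field pol3)"
  by (simp add: h_poly_def right_diff_distrib mult_single)

text \<open>
  Two monomials of the same grade are joined by a chain whose steps each trade one \<open>y_exp\<close> for one
  \<open>w_exp\<close>.
\<close>

lemma homogeneous_binomial:
  fixes G :: "'k::field pol3 set"
  assumes h: "h_poly \<in> ideal_gen G" and gr: "grade n1 n2 n3 m = grade n1 n2 n3 m'"
  shows "monomial m - monomial m' \<in> ideal_gen G"
proof -
  define hx hy hz where hxyz: "hx = \<alpha>h * c1" "hy = \<alpha>h * r12 + \<beta>h * c2" "hz = \<beta>h * c3 - \<alpha>h * r13"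
  have chain: "monomial (i, j + k * hy, z) - monomial (i + k * hx, j, z + k * hz) \<in> ideal_gen G" for i j z k
  proof (induction k arbitrary: j)
    case 0
    show ?case by (simp add: ideal_gen_zero)
  next
    case (Suc k)
    let ?m = "(i + k * hx, j, z + k * hz)"
    have "monomial ?m * h_poly \<in> ideal_gen G" using h by (rule ideal_gen_times)
    then have "monomial (i + k * hx, j + hy, z + k * hz) - monomial (i + Suc k * hx, j, z + Suc k * hz) \<in> ideal_gen G"
      unfolding h_poly_times y_exp_def w_exp_def hxyz[symmetric] by (simp add: algebra_simps)
    from ideal_gen_add[OF Suc.IH[of "j + hy"] this] show ?case by (simp add: algebra_simps)
  qed
  have ordered: "monomial (i, j, z) - monomial (i', j', z') \<in> ideal_gen G"
    if v: "int i' = int i + k * int hx" "int j' = int j - k * int hy" "int z' = int z + k * int hz"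
      and "0 \<le> k" for i j z i' j' z' and k :: int
  proof -
    obtain n where n: "k = int n" using \<open>0 \<le> k\<close> by (rule nonneg_int_cases)
    have "int i' = int (i + n * hx)" "int j = int (j' + n * hy)" "int z' = int (z + n * hz)"
      using v unfolding n by (simp_all only: of_nat_add of_nat_mult)
    then have "i' = i + n * hx" "j = j' + n * hy" "z' = z + n * hz"
      by (simp_all only: of_nat_eq_iff)
    then show ?thesis using chain[of i j' n z] by simp
  qed
  obtain i j z i' j' z' where m: "m = (i, j, z)" "m' = (i', j', z')" by (metis prod_cases3)
  from same_grade[OF gr[unfolded m, symmetric], folded hxyz] obtain k :: int where k:
    "int i' = int i + k * int hx" "int j' = int j - k * int hy" "int z' = int z + k * int hz" .
  show ?thesis
  proof (cases "0 \<le> k")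
    case True
    from ordered[OF k this] show ?thesis by (simp add: m)
  next
    case False
    have "monomial (i', j', z') - monomial (i, j, z) \<in> ideal_gen G"
      using k False by (intro ordered[of i i' "- k" j j' z z']) auto
    from ideal_gen_diff[OF ideal_gen_zero this] show ?thesis by (simp add: m)
  qed
qed

lemma g_exp_eq: "g_exp = p_exp \<eta> \<epsilon>"
  using \<eta>_below by (simp add: g_exp_def p_exp_def)

text \<open>
  Here the choice of \<open>\<eta>\<close> as the least numerator matters: \<open>\<beta> \<ge> \<epsilon>\<close> alone forces \<open>\<alpha> \<ge> \<eta>\<close>.
\<close>

lemma g_dominates:
  assumes "int \<beta> * \<delta>2 < int \<alpha> * \<delta>1" "\<epsilon> \<le> \<beta>"
  shows "mdvd g_exp (p_exp \<alpha> \<beta>)"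
proof -
  have "int \<epsilon> * \<delta>2 \<le> int \<beta> * \<delta>2" using assms(2) \<delta>2_pos by simp
  with assms(1) have "\<eta> \<le> \<alpha>" by (intro \<eta>_least) simp
  with assms(2) show ?thesis by (simp add: g_exp_def p_exp_def add_mono)
qed

lemma A_member: "(\<alpha>, \<beta>) \<in> A_pairs \<longleftrightarrow> (\<beta>, \<alpha>) \<in> A.all_minima \<and> \<beta> < \<epsilon>"
  by (simp add: A_set_eq[OF \<epsilon>_pos])

text \<open>
  Otherwise \<open>\<alpha> / \<beta>\<close> would be a fraction in the interval with denominator below \<open>\<epsilon>\<close>.
\<close>

lemma admissible_below_\<epsilon>:
  assumes "int \<beta> * \<delta>2 < int \<alpha> * \<delta>1" "\<beta> < \<epsilon>"
  shows "A.admissible \<beta> \<alpha>"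
proof (cases "\<beta> = 0")
  case True
  with assms(1) \<delta>1_pos have "0 < \<alpha>" by (simp add: zero_less_mult_iff)
  with True r13_pos show ?thesis by (simp add: A.admissible_def)
next
  case False
  with \<epsilon>_least[of \<beta> \<alpha>] assms have "\<beta> * c3 < \<alpha> * r13" by linarith
  then show ?thesis unfolding A.admissible_def by (simp flip: of_nat_mult)
qed

lemma p_dominated:
  assumes "int \<beta> * \<delta>2 < int \<alpha> * \<delta>1" "\<beta> < \<epsilon>"
  obtains \<alpha>' \<beta>' where "(\<alpha>', \<beta>') \<in> A_pairs" "\<beta>' \<le> \<beta>" "mdvd (p_exp \<alpha>' \<beta>') (p_exp \<alpha> \<beta>)"
proof -
  from A.minima_dominate[OF admissible_below_\<epsilon>[OF assms]] obtain i \<alpha>' \<beta>'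
    where m: "A.minima i = Some (\<beta>', \<alpha>')" "\<beta>' \<le> \<beta>" "\<alpha>' \<le> \<alpha>" "A.objective \<beta>' \<alpha>' \<le> A.objective \<beta> \<alpha>"
    by metis
  have "(\<beta>', \<alpha>') \<in> A.all_minima" using m(1) by (auto simp: A.all_minima_def)
  then have "(\<alpha>', \<beta>') \<in> A_pairs" using m(2) assms(2) by (simp add: A_member)
  moreover have "\<alpha>' * r13 - \<beta>' * c3 \<le> \<alpha> * r13 - \<beta> * c3"
  proof -
    have "int (\<alpha>' * r13) - int (\<beta>' * c3) \<le> int (\<alpha> * r13) - int (\<beta> * c3)"
      using m(4) by (simp add: A.objective_def)
    then show ?thesis by linarith
  qed
  ultimately show thesis using m(2,3) that by (simp add: p_exp_def add_mono)
qed

lemma q_dominated: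
  assumes "int \<gamma> * \<delta>1 < int \<sigma> * \<delta>2"
  obtains \<gamma>' \<sigma>' where "(\<gamma>', \<sigma>') \<in> B_pairs" "mdvd (q_exp \<gamma>' \<sigma>') (q_exp \<gamma> \<sigma>)"
proof -
  have "B.admissible \<gamma> \<sigma>" using assms by (simp add: B.admissible_def)
  from B.minima_dominate[OF this] obtain i \<gamma>' \<sigma>'
    where m: "B.minima i = Some (\<gamma>', \<sigma>')" "\<gamma>' \<le> \<gamma>" "\<sigma>' \<le> \<sigma>" "B.objective \<gamma>' \<sigma>' \<le> B.objective \<gamma> \<sigma>"
    by metis
  have "(\<gamma>', \<sigma>') \<in> B_pairs" using m(1) by (auto simp: B.all_minima_def B_set_eq)
  moreover have "\<sigma>' * c3 - \<gamma>' * r13 \<le> \<sigma> * c3 - \<gamma> * r13"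
  proof -
    have "int (\<sigma>' * c3) - int (\<gamma>' * r13) \<le> int (\<sigma> * c3) - int (\<gamma> * r13)"
      using m(4) by (simp add: B.objective_def)
    then show ?thesis by linarith
  qed
  ultimately show thesis using m(2) that by (simp add: q_exp_def)
qed

lemma p_mon_imageI: "(\<alpha>, \<beta>) \<in> S \<Longrightarrow> monomial (p_exp \<alpha> \<beta>) \<in> p_mon c2 c3 r12 r13 ` S"
  unfolding p_mon_eq[symmetric] by (rule imageI)

lemma q_mon_imageI: "(\<gamma>, \<sigma>) \<in> S \<Longrightarrow> monomial (q_exp \<gamma> \<sigma>) \<in> q_mon c1 c3 r13 ` S"
  unfolding q_mon_eq[symmetric] by (rule imageI)

lemma A_cone:
  assumes "(\<alpha>, \<beta>) \<in> A_pairs"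
  shows "int \<beta> * \<delta>2 < int \<alpha> * \<delta>1"
proof -
  have adm: "int \<beta> * int c3 < int \<alpha> * int r13"
    using assms A.minima_admissible by (auto simp: A_member A.all_minima_def A.admissible_def)
  have "int \<beta> * \<delta>2 * int r13 = int \<beta> * (int r13 * \<delta>2)" by (simp add: ac_simps)
  also have "\<dots> \<le> int \<beta> * (int c3 * \<delta>1)" using slope_less by (intro mult_left_mono) auto
  also have "\<dots> = int \<beta> * int c3 * \<delta>1" by (simp add: ac_simps)
  also have "\<dots> < int \<alpha> * int r13 * \<delta>1" using adm \<delta>1_pos by simp
  finally have "int \<beta> * \<delta>2 * int r13 < int \<alpha> * \<delta>1 * int r13" by (simp add: ac_simps)
  then show ?thesis using r13_pos by simp
qed

lemma B_cone: "(\<gamma>, \<sigma>) \<in> B_pairs \<Longrightarrow> int \<gamma> * \<delta>1 < int \<sigma> * \<delta>2"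
  using B.minima_admissible by (auto simp: B_set_eq B.all_minima_def B.admissible_def)

lemma nonmaximal_in_monomial_ideal:
  assumes "nonmaximal n1 n2 n3 m"
  shows "monomial m \<in> ideal_gen ({monomial g_exp} \<union> P_set \<union> Q_set :: 'k::field pol3 set)" (is "_ \<in> ideal_gen ?G")
  using assms
proof (cases rule: nonmaximal_cases)
  case (1 \<alpha> \<beta>)
  have "monomial (p_exp \<alpha> \<beta>) \<in> ideal_gen ?G"
  proof (cases "\<beta> < \<epsilon>")
    case True
    with 1(1) obtain \<alpha>' \<beta>' where A: "(\<alpha>', \<beta>') \<in> A_pairs" and d: "mdvd (p_exp \<alpha>' \<beta>') (p_exp \<alpha> \<beta>)"
      by (rule p_dominated)
    from p_mon_imageI[OF A] have "monomial (p_exp \<alpha>' \<beta>') \<in> ideal_gen ?G"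
      by (intro ideal_gen_base UnI1[OF UnI2])
    then show ?thesis using d by (rule monomial_mdvd)
  next
    case False
    have "monomial g_exp \<in> ideal_gen ?G" by (intro ideal_gen_base UnI1 singletonI)
    moreover have "mdvd g_exp (p_exp \<alpha> \<beta>)" using 1(1) False by (intro g_dominates) auto
    ultimately show ?thesis by (rule monomial_mdvd)
  qed
  then show ?thesis using 1(2) by (rule monomial_mdvd)
next
  case (2 \<gamma> \<sigma>)
  from q_dominated[OF 2(1)] obtain \<gamma>' \<sigma>'
    where B: "(\<gamma>', \<sigma>') \<in> B_pairs" and d: "mdvd (q_exp \<gamma>' \<sigma>') (q_exp \<gamma> \<sigma>)" .
  from q_mon_imageI[OF B] have "monomial (q_exp \<gamma>' \<sigma>') \<in> ideal_gen ?G"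
    by (intro ideal_gen_base UnI2)
  then show ?thesis using mdvd_trans[OF d 2(2)] by (rule monomial_mdvd)
qed

lemma generators_in_tangent_ideal:
  "{monomial g_exp, h_poly} \<union> P_set \<union> Q_set \<subseteq> (tangent_ideal n1 n2 n3 :: 'k::field pol3 set)"
proof -
  have "monomial g_exp \<in> (tangent_ideal n1 n2 n3 :: 'k pol3 set)"
    unfolding g_exp_eq by (intro monomial_in_tangent_ideal nonmaximal_p_exp \<eta>_above)
  moreover have "h_poly \<in> (tangent_ideal n1 n2 n3 :: 'k pol3 set)"
    unfolding h_poly_def by (intro binomial_in_tangent_ideal grade_y_exp)
  moreover have "P_set \<subseteq> (tangent_ideal n1 n2 n3 :: 'k pol3 set)"
    using A_cone by (auto simp: p_mon_eq intro!: monomial_in_tangent_ideal nonmaximal_p_exp)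
  moreover have "Q_set \<subseteq> (tangent_ideal n1 n2 n3 :: 'k pol3 set)"
    using B_cone by (auto simp: q_mon_eq intro!: monomial_in_tangent_ideal nonmaximal_q_exp)
  ultimately show ?thesis by blast
qed

lemma tangent_ideal_eqI:
  fixes G :: "'k::field pol3 set"
  assumes "G \<subseteq> {monomial g_exp, h_poly} \<union> P_set \<union> Q_set"
    and "{monomial g_exp, h_poly} \<union> P_set \<union> Q_set \<subseteq> ideal_gen G"
  shows "tangent_ideal n1 n2 n3 = ideal_gen G"
proof (intro equalityI subsetI)
  fix f :: "'k pol3" assume f: "f \<in> tangent_ideal n1 n2 n3"
  have "ideal_gen ({monomial g_exp} \<union> P_set \<union> Q_set) \<subseteq> ideal_gen G"
    using assms(2) by (intro ideal_gen_least) auto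
  then have "monomial m \<in> ideal_gen G" if "nonmaximal n1 n2 n3 m" for m
    using nonmaximal_in_monomial_ideal[OF that, where 'k='k] by (rule subsetD)
  moreover have "h_poly \<in> ideal_gen G" using assms(2) by blast
  ultimately show "f \<in> ideal_gen G"
    using f by (intro tangent_ideal_subset[OF f] homogeneous_binomial)
next
  fix f assume "f \<in> ideal_gen G"
  moreover have "ideal_gen G \<subseteq> tangent_ideal n1 n2 n3"
  proof (rule ideal_gen_subset)
    show "G \<subseteq> tangent_ideal n1 n2 n3" using assms(1) generators_in_tangent_ideal by (rule subset_trans)
    show "0 \<in> (tangent_ideal n1 n2 n3 :: 'k pol3 set)" by (simp add: tangent_ideal_def)
  qed (auto intro: tangent_ideal_add tangent_ideal_times)
  ultimately show "f \<in> tangent_ideal n1 n2 n3" by blast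
qed

theorem tangent_ideal_generators:
  "tangent_ideal n1 n2 n3 = ideal_gen ({monomial g_exp, h_poly} \<union> P_set \<union> Q_set :: 'k::field pol3 set)"
  by (rule tangent_ideal_eqI[OF subset_refl ideal_gen_superset])

text \<open>
  As \<open>(\<alpha>h, \<beta>h)\<close> lies on the line of slope \<open>\<delta>2 / \<delta>1\<close>, \<open>\<beta>h > \<epsilon>\<close> implies \<open>\<alpha>h \<ge> \<eta>\<close>, so \<open>g\<close>
  divides the first term of \<open>h\<close>.  The second term is of the same grade, hence nonmaximal as well.
\<close>

theorem tangent_ideal_generators_monomial:
  assumes "\<epsilon> < \<beta>h"
  shows "tangent_ideal n1 n2 n3 = ideal_gen ({monomial g_exp} \<union> P_set \<union> Q_set :: 'k::field pol3 set)"
    (is "_ = ideal_gen ?G")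
proof (rule tangent_ideal_eqI)
  have "int \<epsilon> * \<delta>2 < int \<alpha>h * \<delta>1" using assms \<delta>2_pos by (simp add: h_slope)
  then have "\<eta> \<le> \<alpha>h" by (rule \<eta>_least)
  with assms have "mdvd g_exp y_exp" by (simp add: g_exp_def y_exp_def add_mono)
  moreover have "nonmaximal n1 n2 n3 g_exp"
    unfolding g_exp_eq by (intro nonmaximal_p_exp \<eta>_above)
  ultimately have "nonmaximal n1 n2 n3 y_exp" by (rule nonmaximal_mdvd[rotated])
  moreover from this have "nonmaximal n1 n2 n3 w_exp" using nonmaximal_cong[OF grade_y_exp] by simp
  ultimately have "h_poly \<in> ideal_gen ?G"
    unfolding h_poly_def by (intro ideal_gen_diff nonmaximal_in_monomial_ideal)
  then show "{monomial g_exp, h_poly} \<union> P_set \<union> Q_set \<subseteq> ideal_gen ?G"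
    using ideal_gen_superset[of ?G] by blast
qed blast

text \<open>
  All pairs with \<open>\<alpha> \<delta>1 > \<beta> \<delta>2\<close>, including \<open>(\<eta>, \<epsilon>)\<close>, are treated at once by descent on \<open>\<beta>\<close>.  The
  hypothesis enters at the bottom of the descent, where \<open>\<beta> < \<beta>h \<le> \<epsilon>\<close>.
\<close>

theorem tangent_ideal_generators_binomial:
  assumes "\<beta>h \<le> \<epsilon>"
  shows "tangent_ideal n1 n2 n3 = ideal_gen ({h_poly} \<union> P'_set \<union> Q_set :: 'k::field pol3 set)"
    (is "_ = ideal_gen ?G")
proof (rule tangent_ideal_eqI)
  have p: "monomial (p_exp \<alpha> \<beta>) \<in> ideal_gen ?G" if "int \<beta> * \<delta>2 < int \<alpha> * \<delta>1" for \<alpha> \<beta>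
    using that
  proof (induction \<beta> arbitrary: \<alpha> rule: less_induct)
    case (less \<beta>)
    show ?case
    proof (cases "\<beta> < \<beta>h")
      case True
      then have "\<beta> < \<epsilon>" using assms by simp
      with less.prems obtain \<alpha>' \<beta>'
        where A: "(\<alpha>', \<beta>') \<in> A_pairs" "\<beta>' \<le> \<beta>" and d: "mdvd (p_exp \<alpha>' \<beta>') (p_exp \<alpha> \<beta>)"
        by (rule p_dominated)
      have "(\<alpha>', \<beta>') \<in> {(\<alpha>, \<beta>) \<in> A_pairs. \<beta> < \<beta>h}" using A True by simp
      from p_mon_imageI[OF this] have "monomial (p_exp \<alpha>' \<beta>') \<in> ideal_gen ?G"
        by (intro ideal_gen_base UnI1[OF UnI2])
      then show ?thesis using d by (rule monomial_mdvd)
    next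
      case False
      \<comment> \<open>Replace \<open>y_exp\<close> by \<open>w_exp\<close>: this subtracts \<open>(\<alpha>h, \<beta>h)\<close> from the pair.\<close>
      define x y where "x = \<alpha> - \<alpha>h" and "y = \<beta> - \<beta>h"
      have "int \<beta>h * \<delta>2 \<le> int \<beta> * \<delta>2" using False \<delta>2_pos by simp
      then have "int \<alpha>h * \<delta>1 < int \<alpha> * \<delta>1" using less.prems h_slope by linarith
      then have "\<alpha>h < \<alpha>" using \<delta>1_pos by simp
      then have xy: "\<alpha> = \<alpha>h + x" "\<beta> = \<beta>h + y" using False by (simp_all add: x_def y_def)
      have "int y * \<delta>2 < int x * \<delta>1" using less.prems h_slope by (simp add: xy algebra_simps)
      then have IH: "monomial (p_exp x y) \<in> ideal_gen ?G" using \<beta>h_pos by (intro less.IH) (simp_all add: xy)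
      let ?l = "(0, x * r12 + y * c2, \<alpha> * r13 - \<beta> * c3)"
      have "x * r13 - y * c3 \<le> (\<alpha> * r13 - \<beta> * c3) + (\<beta>h * c3 - \<alpha>h * r13)"
        by (simp add: xy algebra_simps)
      then have "mdvd (p_exp x y) (?l + w_exp)" by (simp add: p_exp_def w_exp_def)
      with IH have w: "monomial (?l + w_exp) \<in> ideal_gen ?G" by (rule monomial_mdvd)
      have "monomial ?l * h_poly \<in> ideal_gen ?G" by (intro ideal_gen_times ideal_gen_base) blast
      from ideal_gen_add[OF this w] have "monomial (?l + y_exp) \<in> ideal_gen ?G" by (simp add: h_poly_times)
      moreover have "?l + y_exp = p_exp \<alpha> \<beta>" by (simp add: p_exp_def y_exp_def xy algebra_simps)
      ultimately show ?thesis by simp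
    qed
  qed
  then have "monomial g_exp \<in> ideal_gen ?G" unfolding g_exp_eq using \<eta>_above by blast
  moreover have "P_set \<subseteq> ideal_gen ?G" using p A_cone by (auto simp: p_mon_eq)
  ultimately show "{monomial g_exp, h_poly} \<union> P_set \<union> Q_set \<subseteq> ideal_gen ?G"
    using ideal_gen_superset[of ?G] by blast
  show "?G \<subseteq> {monomial g_exp, h_poly} \<union> P_set \<union> Q_set"
    by (intro Un_mono image_mono order_refl) auto
qed

end

section \<open>Groebner bases\<close>

context gluing_tangent
begin

lemma revlex_w_y: "revlex_less w_exp y_exp"
  using w_z_pos arg_cong[OF grade_y_exp, of snd] by (simp add: grade_def y_exp_def w_exp_def)

lemma lead_mon_h_poly: "lead_mon (h_poly :: 'k::field pol3) = y_exp"
  unfolding h_poly_def by (rule lead_mon_binomial[OF revlex_w_y])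

lemma h_poly_nonzero: "(h_poly :: 'k::field pol3) \<noteq> 0"
proof
  assume "h_poly = (0 :: 'k pol3)"
  then have "Poly_Mapping.lookup (h_poly :: 'k pol3) y_exp = 0" by simp
  moreover have "w_exp \<noteq> y_exp" using revlex_w_y revlex_less_irrefl by metis
  ultimately show False by (simp add: h_poly_def lookup_minus lookup_single)
qed

text \<open>
  The leading monomial is not alone in its class, and monomials of a class form a chain in which
  every step down in the order replaces a \<open>y_exp\<close> by a \<open>w_exp\<close>.
\<close>

lemma y_exp_mdvd_lead_mon:
  fixes f :: "'k::field pol3"
  assumes f: "f \<in> tangent_ideal n1 n2 n3" "f \<noteq> 0" and max: "\<not> nonmaximal n1 n2 n3 (lead_mon f)"
  shows "mdvd y_exp (lead_mon f)"
proof -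
  let ?m = "lead_mon f" and ?\<theta> = "grade n1 n2 n3"
  note lead = lead_mon_greatest[OF f(2)]
  from tangent_ideal_class_partner[OF f(1) max lead(1)]
  obtain m' where m': "m' \<noteq> ?m" "m' \<in> Poly_Mapping.keys f" "?\<theta> m' = ?\<theta> ?m" by metis
  from lead(2)[OF m'(2,1)] have less: "revlex_less m' ?m" .
  obtain i j z i' j' z' where e: "?m = (i, j, z)" "m' = (i', j', z')" by (metis prod_cases3)
  from same_grade[OF m'(3)[unfolded e]] obtain k :: int where k:
    "int i' = int i + k * int (\<alpha>h * c1)"
    "int j' = int j - k * int (\<alpha>h * r12 + \<beta>h * c2)"
    "int z' = int z + k * int (\<beta>h * c3 - \<alpha>h * r13)" .
  have "i' + j' + z' = i + j + z" using m'(3) e by (simp add: grade_def)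
  with less have z: "z \<le> z'" by (auto simp: e)
  \<comment> \<open>The trailing monomials of a class are those with more \<open>z\<close>, hence with less \<open>y\<close>.\<close>
  have "0 < k"
  proof (rule ccontr)
    assume "\<not> 0 < k"
    then consider "k = 0" | "k \<le> - 1" by linarith
    then show False
    proof cases
      case 1
      with k e m'(1) show False by simp
    next
      case 2
      have "0 < int (\<beta>h * c3 - \<alpha>h * r13)" using w_z_pos by (simp only: of_nat_0_less_iff zero_less_diff)
      moreover have "k < 0" using 2 by simp
      ultimately have "k * int (\<beta>h * c3 - \<alpha>h * r13) < 0" by (intro mult_neg_pos)
      with k(3) z show False by linarith
    qed
  qed
  define ydeg where "ydeg = \<alpha>h * r12 + \<beta>h * c2"
  have "1 * int ydeg \<le> k * int ydeg" using \<open>0 < k\<close> by (intro mult_right_mono) auto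
  with k(2) have "ydeg \<le> j" unfolding ydeg_def[symmetric] by linarith
  then show ?thesis by (simp add: e y_exp_def ydeg_def)
qed

lemma generator_cases:
  assumes "f \<in> {monomial g_exp, h_poly} \<union> P_set \<union> (Q_set :: 'k::field pol3 set)" "f \<noteq> h_poly"
  obtains m where "f = monomial m"
proof -
  consider "f = monomial g_exp" | "f \<in> P_set" | "f \<in> Q_set" using assms by blast
  then show thesis
  proof cases
    case 1
    then show thesis by (rule that)
  next
    case 2
    then obtain \<alpha> \<beta> where "f = p_mon c2 c3 r12 r13 (\<alpha>, \<beta>)" by (metis imageE surj_pair)
    then show thesis using p_mon_eq that by metis
  next
    case 3
    then obtain \<gamma> \<sigma> where "f = q_mon c1 c3 r13 (\<gamma>, \<sigma>)" by (metis imageE surj_pair)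
    then show thesis using q_mon_eq that by metis
  qed
qed

lemma finite_A_pairs: "finite A_pairs"
proof -
  have "A_pairs \<subseteq> the ` A_seq r13 c3 ` {..A_last r13 c3 \<epsilon>}"
    unfolding A_set_def by (force simp: image_iff)
  then show ?thesis by (rule finite_subset) simp
qed

lemma B_objective_range: "(\<gamma>, \<sigma>) \<in> B_pairs \<Longrightarrow> B.objective \<gamma> \<sigma> \<in> {1..int c3}"
proof -
  assume B: "(\<gamma>, \<sigma>) \<in> B_pairs"
  have cone: "int \<gamma> * \<delta>1 < int \<sigma> * \<delta>2" using B by (rule B_cone)
  then have "0 < \<sigma>" using \<delta>1_pos by (cases "\<sigma> = 0") (simp_all add: mult_less_0_iff)
  with cone have "\<gamma> * r13 < \<sigma> * c3" by (intro cone_z_pos) auto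
  then have "int (\<gamma> * r13) < int (\<sigma> * c3)" by (simp only: of_nat_less_iff)
  then show ?thesis using B.objective_le B unfolding B_set_eq by (simp add: B.objective_def)
qed

lemma A_objective_range: "(\<alpha>, \<beta>) \<in> A_pairs \<Longrightarrow> A.objective \<beta> \<alpha> \<in> {1..int c3}"
proof -
  assume "(\<alpha>, \<beta>) \<in> A_pairs"
  then have A: "(\<beta>, \<alpha>) \<in> A.all_minima" by (simp add: A_member)
  then have "0 < A.objective \<beta> \<alpha>"
    using A.minima_admissible by (auto simp: A.all_minima_def A.admissible_def A.objective_def)
  then show ?thesis using A.objective_le[OF A] r13_less by simp
qed

lemma finite_B_pairs: "finite B_pairs"
proof (rule inj_on_finite)
  show "inj_on (\<lambda>(\<gamma>, \<sigma>). B.objective \<gamma> \<sigma>) B_pairs" unfolding B_set_eq by (rule B.inj_on_objective)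
  show "(\<lambda>(\<gamma>, \<sigma>). B.objective \<gamma> \<sigma>) ` B_pairs \<subseteq> {1..int c3}" using B_objective_range by auto
qed simp

text \<open>
  Without \<open>h\<close> the ideal is generated by monomials and there is nothing to do.  With \<open>h\<close>, a nonmaximal
  monomial is divisible by a monomial of \<open>M\<close>, by \<open>y_exp\<close>, or by the trailing term \<open>w_exp\<close> of \<open>h\<close>; the
  last possibility has to be excluded or reduced, for which the two families of monomials are examined.
\<close>

theorem groebner_basis_generating_subset:
  fixes M :: "'k::field pol3 set"
  assumes M: "M \<subseteq> {monomial g_exp, h_poly} \<union> P_set \<union> Q_set" and gen: "ideal_gen M = tangent_ideal n1 n2 n3"
  shows "groebner_basis M (tangent_ideal n1 n2 n3)"
proof (rule groebner_basisI)
  show "finite M" using M by (rule finite_subset) (use finite_A_pairs finite_B_pairs in simp)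
  have only_monomials: "\<exists>m. f = monomial m" if "f \<in> M" "f \<noteq> h_poly" for f
    using that M by (meson generator_cases subsetD)
  show "0 \<notin> M"
  proof
    assume "0 \<in> M"
    with only_monomials[of 0] h_poly_nonzero obtain m where "(0 :: 'k pol3) = monomial m" by metis
    then show False by (metis keys_single keys_zero insert_not_empty zero_neq_one)
  qed
  show "M \<subseteq> tangent_ideal n1 n2 n3" using gen ideal_gen_superset by blast
  have keys_M: "\<exists>f'\<in>M. \<exists>k\<in>Poly_Mapping.keys f'. mdvd k m"
    if "f \<in> tangent_ideal n1 n2 n3" "m \<in> Poly_Mapping.keys f" for f :: "'k pol3" and m
    using keys_ideal_gen[of f M m] that unfolding gen mdvd_def by blast
  have keys_monomial: "k = lead_mon f'" if "f' \<in> M" "f' \<noteq> h_poly" "k \<in> Poly_Mapping.keys f'" for f' k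
  proof -
    from only_monomials[OF that(1,2)] obtain m where "f' = monomial m" by blast
    with that(3) show ?thesis by (simp add: lead_mon_monomial)
  qed
  fix f :: "'k pol3" assume f: "f \<in> tangent_ideal n1 n2 n3" "f \<noteq> 0"
  have "\<exists>f'\<in>M. mdvd (lead_mon f') (lead_mon f)"
  proof (cases "h_poly \<in> M")
    case False
    from keys_M[OF f(1) lead_mon_greatest(1)[OF f(2)]] obtain f' k
      where k: "f' \<in> M" "k \<in> Poly_Mapping.keys f'" "mdvd k (lead_mon f)" by blast
    with False have "f' \<noteq> h_poly" by metis
    with k keys_monomial[of f' k] show ?thesis by metis
  next
    case True
    have h_lead: ?thesis if "mdvd y_exp (lead_mon f)"
      using that True lead_mon_h_poly by metis
    have lead_or_w: "(\<exists>f'\<in>M. mdvd (lead_mon f') m) \<or> mdvd w_exp m" if m: "nonmaximal n1 n2 n3 m" for m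
    proof -
      have "m \<in> Poly_Mapping.keys (monomial m :: 'k pol3)" by simp
      from keys_M[OF monomial_in_tangent_ideal[OF m] this] obtain f' k
        where k: "f' \<in> M" "k \<in> Poly_Mapping.keys f'" "mdvd k m" by blast
      show ?thesis
      proof (cases "f' = h_poly")
        case False
        with k keys_monomial[of f' k] show ?thesis by metis
      next
        case True
        have "Poly_Mapping.keys f' \<subseteq> {y_exp, w_exp}"
          unfolding True h_poly_def using keys_diff[of "monomial y_exp :: 'k pol3" "monomial w_exp"] by (simp add: insert_commute)
        with k True lead_mon_h_poly[where 'k='k] show ?thesis by (metis empty_iff insert_iff subsetD)
      qed
    qed
    \<comment> \<open>\<open>w_exp\<close> involves \<open>x\<close>, the monomials \<open>p\<close> do not.\<close>
    have p: "\<exists>f'\<in>M. mdvd (lead_mon f') (p_exp \<alpha> \<beta>)" if "int \<beta> * \<delta>2 < int \<alpha> * \<delta>1" for \<alpha> \<beta>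
    proof -
      have "\<not> mdvd w_exp (p_exp \<alpha> \<beta>)" using \<alpha>h_pos c1_pos by (simp add: w_exp_def p_exp_def)
      with lead_or_w[OF nonmaximal_p_exp[OF that]] show ?thesis by blast
    qed
    \<comment> \<open>If \<open>w_exp\<close> divides a monomial \<open>q\<close>, subtracting \<open>(\<alpha>h, \<beta>h)\<close> gives a smaller divisor of the same kind.\<close>
    have q: "\<exists>f'\<in>M. mdvd (lead_mon f') (q_exp \<gamma> \<sigma>)" if "int \<gamma> * \<delta>1 < int \<sigma> * \<delta>2" for \<gamma> \<sigma>
      using that
    proof (induction \<gamma> arbitrary: \<sigma> rule: less_induct)
      case (less \<gamma>)
      show ?case
      proof (cases "mdvd w_exp (q_exp \<gamma> \<sigma>)")
        case False
        with lead_or_w[OF nonmaximal_q_exp[OF less.prems]] show ?thesis by blast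
      next
        case True
        then have "\<alpha>h * c1 \<le> \<gamma> * c1" by (simp only: w_exp_def q_exp_def mdvd_iff)
        then have \<gamma>: "\<alpha>h \<le> \<gamma>" using c1_pos by simp
        then have "int \<alpha>h * \<delta>1 \<le> int \<gamma> * \<delta>1" using \<delta>1_pos by simp
        then have "int \<beta>h * \<delta>2 < int \<sigma> * \<delta>2" using less.prems h_slope by linarith
        then have \<sigma>: "\<beta>h \<le> \<sigma>" using \<delta>2_pos by simp
        define x y where "x = \<gamma> - \<alpha>h" and "y = \<sigma> - \<beta>h"
        have xy: "\<gamma> = \<alpha>h + x" "\<sigma> = \<beta>h + y" using \<gamma> \<sigma> by (simp_all add: x_def y_def)
        have "int x * \<delta>1 < int y * \<delta>2" using less.prems h_slope by (simp add: xy algebra_simps)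
        then obtain f' where f': "f' \<in> M" "mdvd (lead_mon f') (q_exp x y)"
          using less.IH[of x y] \<alpha>h_pos by (auto simp: xy)
        have "y * c3 - x * r13 \<le> \<sigma> * c3 - \<gamma> * r13" using w_z_pos by (simp add: xy algebra_simps)
        moreover have "x * c1 \<le> \<gamma> * c1" by (simp add: xy)
        ultimately have "mdvd (q_exp x y) (q_exp \<gamma> \<sigma>)" by (simp add: q_exp_def)
        with f' show ?thesis using mdvd_trans by blast
      qed
    qed
    show ?thesis
    proof (cases "nonmaximal n1 n2 n3 (lead_mon f)")
      case False
      with f show ?thesis by (intro h_lead y_exp_mdvd_lead_mon)
    next
      case True
      then show ?thesis
      proof (cases rule: nonmaximal_cases)
        case (1 \<alpha> \<beta>)
        from p[OF 1(1)] 1(2) show ?thesis using mdvd_trans by blast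
      next
        case (2 \<gamma> \<sigma>)
        from q[OF 2(1)] 2(2) show ?thesis using mdvd_trans by blast
      qed
    qed
  qed
  then show "\<exists>f'\<in>M. \<exists>l. lead_mon f = l + lead_mon f'" unfolding mdvd_def by blast
qed

section \<open>Counting generators\<close>

text \<open>
  The pair \<open>(1, 0)\<close> is clear.  If \<open>\<beta> > 0\<close>, as \<open>\<alpha>\<close> is least with \<open>\<alpha> r13 > \<beta> c3\<close>, the fraction \<open>(\<alpha> - 1) / \<beta>\<close> is at most \<open>c3 / r13\<close>; if
  \<open>\<alpha> - 1 \<ge> \<eta>\<close>, it would also exceed \<open>\<delta>2 / \<delta>1\<close>, contrary to \<open>\<beta> < \<epsilon>\<close>.
\<close>

lemma A_pairs_le_\<eta>:
  assumes "(\<alpha>, \<beta>) \<in> A_pairs"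
  shows "\<alpha> \<le> \<eta>"
proof (rule ccontr)
  assume "\<not> \<alpha> \<le> \<eta>"
  then obtain s where s: "\<alpha> = Suc s" "\<eta> \<le> s" by (cases \<alpha>) auto
  obtain i where i: "A.minima i = Some (\<beta>, \<alpha>)" and \<beta>: "\<beta> < \<epsilon>"
    using assms by (auto simp: A_member A.all_minima_def)
  have "\<not> A.admissible \<beta> s" using A.minima_secondary[OF i] A.admissible_iff[of \<beta> s] s(1) by simp
  then have le: "s * r13 \<le> \<beta> * c3" unfolding A.admissible_def by (simp flip: of_nat_mult)
  show False
  proof (cases "\<beta> = 0")
    case True
    with le r13_pos s(2) \<eta>_pos show False by simp
  next
    case False
    have "int \<beta> * \<delta>2 \<le> int \<epsilon> * \<delta>2" using \<beta> \<delta>2_pos by simp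
    also have "\<dots> < int \<eta> * \<delta>1" by (rule \<eta>_above)
    also have "\<dots> \<le> int s * \<delta>1" using s(2) \<delta>1_pos by simp
    finally have "\<epsilon> \<le> \<beta>" using False le by (intro \<epsilon>_least) auto
    with \<beta> show False by simp
  qed
qed

text \<open>
  A common exponent of \<open>z\<close> means that \<open>(\<alpha> + \<gamma>, \<beta> + \<sigma>)\<close> has slope exactly \<open>c3 / r13\<close>, whence
  \<open>\<alpha> + \<gamma> \<ge> \<eta>\<close>.  Suppose that \<open>A\<close> goes on to a smaller exponent at \<open>(\<alpha>', \<beta>')\<close>, and look at the
  difference \<open>(x, y) = (\<alpha>' - \<alpha>, \<beta>' - \<beta>)\<close>.  If it increases the degree, it violates the minimality of
  \<open>\<epsilon>\<close>; if it preserves the degree, it is a multiple of \<open>(\<alpha>h, \<beta>h)\<close> and too large.  If it decreases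
  the degree, it is a point of the cone of \<open>B\<close> with smaller exponent than \<open>(\<gamma>, \<sigma>)\<close>; as this is a
  record, \<open>x > \<gamma>\<close>, so \<open>\<alpha>' > \<alpha> + \<gamma> \<ge> \<eta>\<close>, which is impossible.
\<close>

lemma no_common_exponent_above:
  assumes A: "(\<alpha>, \<beta>) \<in> A_pairs" and A': "(\<alpha>', \<beta>') \<in> A_pairs" "\<beta>' < \<beta>h" and B: "(\<gamma>, \<sigma>) \<in> B_pairs"
    and common: "A.objective \<beta> \<alpha> = B.objective \<gamma> \<sigma>"
    and less: "A.objective \<beta>' \<alpha>' < A.objective \<beta> \<alpha>"
  shows False
proof -
  obtain i where i: "A.minima i = Some (\<beta>, \<alpha>)" using A by (auto simp: A_member A.all_minima_def)
  obtain j where j: "A.minima j = Some (\<beta>', \<alpha>')" and \<beta>': "\<beta>' < \<epsilon>"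
    using A'(1) by (auto simp: A_member A.all_minima_def)
  obtain l where l: "B.minima l = Some (\<gamma>, \<sigma>)" using B by (auto simp: B_set_eq B.all_minima_def)
  have "\<beta> < \<beta>'"
    using A.minima_optimal[OF i A.minima_admissible[OF j]] less by (meson leI not_le)
  moreover have "\<alpha> \<le> \<alpha>'"
  proof -
    have "int \<beta> * int c3 \<le> int \<beta>' * int c3" using \<open>\<beta> < \<beta>'\<close> by (intro mult_right_mono) auto
    then have "A.admissible \<beta> \<alpha>'" using A.minima_admissible[OF j] by (simp add: A.admissible_def)
    then show ?thesis using A.minima_secondary[OF i] A.admissible_iff by simp
  qed
  ultimately obtain x y where x: "\<alpha>' = \<alpha> + x" and y: "\<beta>' = \<beta> + y" "0 < y"
    by (metis less_imp_add_positive le_Suc_ex)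
  have "\<eta> \<le> \<alpha> + \<gamma>"
  proof -
    have on_line: "int (\<alpha> + \<gamma>) * int r13 = int (\<beta> + \<sigma>) * int c3"
      using common by (simp add: A.objective_def B.objective_def algebra_simps)
    have cone: "int \<gamma> * \<delta>1 < int \<sigma> * \<delta>2" using B by (rule B_cone)
    then have "0 < \<sigma>" using \<delta>1_pos by (cases "\<sigma> = 0") (simp_all add: mult_less_0_iff)
    then have pos: "0 < int (\<beta> + \<sigma>)" by simp
    have "int (\<beta> + \<sigma>) * \<delta>2 * int r13 = int (\<beta> + \<sigma>) * (int r13 * \<delta>2)" by (simp only: ac_simps)
    also have "\<dots> < int (\<beta> + \<sigma>) * (int c3 * \<delta>1)" using slope_less pos by (rule mult_strict_left_mono)
    also have "\<dots> = int (\<beta> + \<sigma>) * int c3 * \<delta>1" by (simp only: ac_simps)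
    also have "\<dots> = int (\<alpha> + \<gamma>) * int r13 * \<delta>1" by (simp only: on_line)
    finally have "int (\<beta> + \<sigma>) * \<delta>2 * int r13 < int (\<alpha> + \<gamma>) * \<delta>1 * int r13" by (simp only: ac_simps)
    then have above: "int (\<beta> + \<sigma>) * \<delta>2 < int (\<alpha> + \<gamma>) * \<delta>1" using r13_pos by simp
    have "(\<alpha> + \<gamma>) * r13 \<le> (\<beta> + \<sigma>) * c3"
      using on_line unfolding of_nat_mult[symmetric] by (simp only: of_nat_eq_iff order_refl)
    with above pos have "\<epsilon> \<le> \<beta> + \<sigma>" by (intro \<epsilon>_least) auto
    then have "int \<epsilon> * \<delta>2 \<le> int (\<beta> + \<sigma>) * \<delta>2" using \<delta>2_pos by (intro mult_right_mono) auto
    with above show ?thesis by (intro \<eta>_least) linarith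
  qed
  moreover have "\<alpha>' \<le> \<eta>" using A'(1) by (rule A_pairs_le_\<eta>)
  ultimately have "x \<le> \<gamma>" using x by simp
  have obj: "A.objective \<beta>' \<alpha>' = A.objective \<beta> \<alpha> + int x * int r13 - int y * int c3"
    by (simp add: A.objective_def x y algebra_simps)
  consider "int y * \<delta>2 < int x * \<delta>1" | "int x * \<delta>1 = int y * \<delta>2" | "int x * \<delta>1 < int y * \<delta>2" by linarith
  then show False
  proof cases
    case 1
    have "int (x * r13) \<le> int (y * c3)" using obj less by simp
    then have "\<epsilon> \<le> y" using 1 y(2) by (intro \<epsilon>_least[of y x]) (simp_all only: of_nat_le_iff)
    with \<beta>' y show False by simp
  next
    case 2
    then obtain k where k: "int y = k * int \<beta>h" by (rule h_multiple)
    with y(2) have "0 < k * int \<beta>h" by simp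
    then have "0 < k" by (simp add: zero_less_mult_iff)
    then have "1 * int \<beta>h \<le> k * int \<beta>h" by (intro mult_right_mono) auto
    with k A'(2) y(1) show False by linarith
  next
    case 3
    then have "B.admissible x y" by (simp add: B.admissible_def)
    from B.minima_optimal[OF l this \<open>x \<le> \<gamma>\<close>]
    have "A.objective \<beta> \<alpha> \<le> int y * int c3 - int x * int r13" by (simp add: common B.objective_def)
    then have "A.objective \<beta>' \<alpha>' \<le> 0" using obj by simp
    moreover have "0 < A.objective \<beta>' \<alpha>'" using A_objective_range[OF A'(1)] by simp
    ultimately show False by simp
  qed
qed

text \<open>
  The exponents of \<open>z\<close> are injective on both sets with values in \<open>{1..c3}\<close>; a common value is the
  least one of the first set, so there is at most one.
\<close>

lemma card_pairs:
  "card {(\<alpha>, \<beta>) \<in> A_pairs. \<beta> < \<beta>h} + card B_pairs \<le> c3 + 1"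
proof -
  let ?A = "{(\<alpha>, \<beta>) \<in> A_pairs. \<beta> < \<beta>h}"
  define a where "a = (\<lambda>(\<alpha>, \<beta>). A.objective \<beta> \<alpha>)"
  define b where "b = (\<lambda>(\<gamma>, \<sigma>). B.objective \<gamma> \<sigma>)"
  have inj_a: "inj_on a ?A"
  proof (rule inj_onI)
    fix v v' assume v: "v \<in> ?A" "v' \<in> ?A" "a v = a v'"
    obtain \<alpha> \<beta> \<alpha>' \<beta>' where e: "v = (\<alpha>, \<beta>)" "v' = (\<alpha>', \<beta>')" by (metis surj_pair)
    have "(\<beta>, \<alpha>) \<in> A.all_minima" "(\<beta>', \<alpha>') \<in> A.all_minima" using v(1,2) by (simp_all add: e A_member)
    from inj_onD[OF A.inj_on_objective _ this] v(3) show "v = v'" by (simp add: e a_def)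
  qed
  have inj_b: "inj_on b B_pairs" unfolding B_set_eq b_def by (rule B.inj_on_objective)
  have fin: "finite ?A" using finite_A_pairs by (rule rev_finite_subset) auto
  have "card (a ` ?A \<inter> b ` B_pairs) \<le> Suc 0"
  proof -
    have le: "\<zeta> \<le> \<zeta>'" if z: "\<zeta> \<in> a ` ?A \<inter> b ` B_pairs" "\<zeta>' \<in> a ` ?A" for \<zeta> \<zeta>'
    proof (rule ccontr)
      assume nle: "\<not> \<zeta> \<le> \<zeta>'"
      obtain \<alpha> \<beta> where 1: "(\<alpha>, \<beta>) \<in> A_pairs" "\<zeta> = A.objective \<beta> \<alpha>" using z(1) by (auto simp: a_def)
      obtain \<gamma> \<sigma> where 2: "(\<gamma>, \<sigma>) \<in> B_pairs" "\<zeta> = B.objective \<gamma> \<sigma>" using z(1) by (auto simp: b_def)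
      obtain \<alpha>' \<beta>' where 3: "(\<alpha>', \<beta>') \<in> A_pairs" "\<beta>' < \<beta>h" "\<zeta>' = A.objective \<beta>' \<alpha>'"
        using z(2) by (auto simp: a_def)
      show False
        using no_common_exponent_above[OF 1(1) 3(1,2) 2(1)] 1(2) 2(2) 3(3) nle by simp
    qed
    have eq: "\<zeta> = \<zeta>'" if "\<zeta> \<in> a ` ?A \<inter> b ` B_pairs" "\<zeta>' \<in> a ` ?A \<inter> b ` B_pairs" for \<zeta> \<zeta>'
      using le[OF that(1)] le[OF that(2)] that by (meson IntD1 order_antisym)
    have "finite (a ` ?A \<inter> b ` B_pairs)" using finite_imageI[OF fin] by (rule finite_Int[OF disjI1])
    from card_le_Suc0_iff_eq[OF this] eq show ?thesis by (simp only: Ball_def) blast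
  qed
  moreover have "card (a ` ?A \<union> b ` B_pairs) \<le> c3"
  proof -
    have "a ` ?A \<union> b ` B_pairs \<subseteq> {1..int c3}"
      using A_objective_range B_objective_range by (auto simp: a_def b_def)
    from card_mono[OF _ this] show ?thesis by simp
  qed
  moreover have "card ?A + card B_pairs = card (a ` ?A \<union> b ` B_pairs) + card (a ` ?A \<inter> b ` B_pairs)"
    unfolding card_image[OF inj_a, symmetric] card_image[OF inj_b, symmetric]
    using fin finite_B_pairs by (intro card_Un_Int) auto
  ultimately show ?thesis by linarith
qed

text \<open>
  If \<open>\<beta>h > \<epsilon>\<close>, the condition \<open>\<beta> < \<beta>h\<close> holds on all of \<open>A\<close>, so both cases have one
  generator besides the monomials counted above.
\<close>

theorem mingen_number_tangent_ideal:
  "mingen_number (tangent_ideal n1 n2 n3 :: 'k::field pol3 set) \<le> c3 + 2"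
proof -
  obtain f :: "'k pol3" where f: "ideal_gen ({f} \<union> P'_set \<union> Q_set) = tangent_ideal n1 n2 n3"
  proof (cases "\<beta>h \<le> \<epsilon>")
    case True
    from tangent_ideal_generators_binomial[OF this, symmetric] show thesis by (rule that)
  next
    case False
    then have eq: "{(\<alpha>, \<beta>) \<in> A_pairs. \<beta> < \<beta>h} = A_pairs" by (auto simp: A_member)
    have "\<epsilon> < \<beta>h" using False by simp
    from tangent_ideal_generators_monomial[OF this, symmetric, where 'k='k] show thesis
      by (intro that[of "monomial g_exp"]) (simp only: eq)
  qed
  let ?A = "{(\<alpha>, \<beta>) \<in> A_pairs. \<beta> < \<beta>h}"
  have fin: "finite ?A" using finite_A_pairs by (rule rev_finite_subset) auto
  let ?G = "{f} \<union> P'_set \<union> Q_set"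
  have "card ?G \<le> card ({f} \<union> (P'_set :: 'k pol3 set)) + card (Q_set :: 'k pol3 set)" by (rule card_Un_le)
  also have "card ({f} \<union> (P'_set :: 'k pol3 set)) \<le> card {f} + card (P'_set :: 'k pol3 set)" by (rule card_Un_le)
  also have "card (P'_set :: 'k pol3 set) \<le> card ?A" using fin by (rule card_image_le)
  also have "card (Q_set :: 'k pol3 set) \<le> card B_pairs" using finite_B_pairs by (rule card_image_le)
  finally have "card ?G \<le> c3 + 2" using card_pairs by simp
  moreover have "mingen_number (tangent_ideal n1 n2 n3 :: 'k pol3 set) \<le> card ?G"
    unfolding mingen_number_def
  proof (rule Least_le, intro exI conjI)
    show "finite ?G" using fin finite_B_pairs by simp
    show "card ?G = card ?G" ..
    show "ideal_gen ?G = tangent_ideal n1 n2 n3" by (fact f)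
  qed
  ultimately show ?thesis by simp
qed

end

section \<open>Arithmetic of the semigroup\<close>

lemma semigroup_gen_pair:
  assumes "p \<noteq> q"
  shows "x \<in> semigroup_gen {p, q} \<longleftrightarrow> (\<exists>i j. x = i * p + j * q)"
proof
  assume "\<exists>i j. x = i * p + j * q"
  then obtain i j where "x = i * p + j * q" by blast
  then have "x = (\<Sum>n\<in>{p, q}. (if n = p then i else j) * n)" using assms by simp
  then show "x \<in> semigroup_gen {p, q}"
    unfolding semigroup_gen_def by (intro CollectI exI[of _ "\<lambda>n. if n = p then i else j"]) simp
qed (use assms in \<open>auto simp: semigroup_gen_def\<close>)

lemma least_multiplier_pair:
  assumes "p \<noteq> q" "0 < p"
  shows least_multiplier_pos: "0 < least_multiplier n {p, q}"
    and least_multiplier_le: "0 < c \<Longrightarrow> c * n = i * p + j * q \<Longrightarrow> least_multiplier n {p, q} \<le> c"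
proof -
  let ?P = "\<lambda>c. 0 < c \<and> c * n \<in> semigroup_gen {p, q}"
  have "p * n = n * p + 0 * q" by simp
  then have "?P p" using assms unfolding semigroup_gen_pair[OF assms(1)] by blast
  then have "?P (LEAST c. ?P c)" by (rule LeastI)
  then show "0 < least_multiplier n {p, q}" by (simp add: least_multiplier_def)
  assume "0 < c" "c * n = i * p + j * q"
  then have "?P c" unfolding semigroup_gen_pair[OF assms(1)] by blast
  then show "least_multiplier n {p, q} \<le> c" unfolding least_multiplier_def by (rule Least_le)
qed

text \<open>
  Minimality of \<open>c3\<close> and \<open>c2\<close> forces \<open>c2 n2 = c3 n3\<close> with \<open>c2\<close>, \<open>c3\<close> coprime, so that \<open>n2 = c3 t\<close> and
  \<open>n3 = c2 t\<close>.  It remains to see \<open>c1 = t\<close>: \<open>t\<close> divides \<open>c1\<close> because it is coprime to \<open>n1\<close>, and \<open>t n1\<close>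
  is in \<open>\<langle>n2, n3\<rangle>\<close>.
\<close>

lemma gluing_structure:
  fixes n1 n2 n3 c1 c2 c3 r12 r13 r23 r32 :: nat
  assumes n: "0 < n1" "n1 < n2" "n2 < n3" and gcd1: "Gcd {n1, n2, n3} = 1"
    and c1: "c1 = least_multiplier n1 {n2, n3}"
    and c2: "c2 = least_multiplier n2 {n1, n3}"
    and c3: "c3 = least_multiplier n3 {n1, n2}"
    and rel: "c1 * n1 = r12 * n2 + r13 * n3" "c2 * n2 = r23 * n3" "c3 * n3 = r32 * n2"
  shows "0 < c1" "c3 < c2" "coprime c2 c3" "n1 = r12 * c3 + r13 * c2" "n2 = c1 * c3" "n3 = c1 * c2"
    "coprime n1 c1"
proof -
  have pos: "0 < c1" "0 < c2" "0 < c3"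
    unfolding c1 c2 c3 using n by (auto intro!: least_multiplier_pos)
  have le1: "c1 \<le> c" if "0 < c" "c * n1 = i * n2 + j * n3" for c i j
    unfolding c1 using n that by (intro least_multiplier_le) auto
  have le2: "c2 \<le> c" if "0 < c" "c * n2 = i * n1 + j * n3" for c i j
    unfolding c2 using n that by (intro least_multiplier_le) auto
  have le3: "c3 \<le> c" if "0 < c" "c * n3 = i * n1 + j * n2" for c i j
    unfolding c3 using n that by (intro least_multiplier_le) auto
  have eq: "c2 * n2 = c3 * n3"
  proof -
    have "0 < r23 * n3" unfolding rel(2)[symmetric] using pos(2) n by simp
    then have "0 < r23" by simp
    then have "c3 \<le> r23" using rel(2) by (intro le3[of r23 0 c2]) simp_all
    then have 1: "c3 * n3 \<le> c2 * n2" using rel(2) by simp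
    have "0 < r32 * n2" unfolding rel(3)[symmetric] using pos(3) n by simp
    then have "0 < r32" by simp
    then have "c2 \<le> r32" using rel(3) by (intro le2[of r32 0 c3]) simp_all
    then have "c2 * n2 \<le> c3 * n3" using rel(3) by simp
    with 1 show ?thesis by simp
  qed
  show cop: "coprime c2 c3"
  proof -
    define e where "e = gcd c2 c3"
    obtain u v where uv: "c2 = e * u" "c3 = e * v" unfolding e_def by (meson dvdE gcd_dvd1 gcd_dvd2)
    have e: "0 < e" and u: "0 < u" using uv pos by auto
    have "u * n2 = 0 * n1 + v * n3" using eq e unfolding uv by (simp add: mult.assoc)
    with u have "c2 \<le> u" by (rule le2)
    then have "e = 1" using uv(1) e u by (cases e) auto
    then show ?thesis unfolding e_def by (simp add: coprime_iff_gcd_eq_1)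
  qed
  have "c3 dvd c2 * n2" unfolding eq by simp
  then have "c3 dvd n2" using cop by (simp add: coprime_dvd_mult_right_iff coprime_commute)
  then obtain t where t2: "n2 = c3 * t" by (auto elim: dvdE)
  have t3: "n3 = c2 * t" using eq pos(3) unfolding t2 by (simp add: mult.left_commute)
  have t: "0 < t" using t2 n by (cases t) auto
  have cop1: "coprime n1 t"
  proof (rule coprimeI)
    fix k assume "k dvd n1" "k dvd t"
    then have "k dvd Gcd {n1, n2, n3}" using t2 t3 by (intro Gcd_greatest) auto
    then show "k dvd 1" unfolding gcd1 .
  qed
  have "c1 * n1 = t * (r12 * c3 + r13 * c2)" unfolding rel(1) t2 t3 by (simp add: algebra_simps)
  then have "t dvd c1 * n1" by simp
  then have "t dvd c1" using cop1 by (simp add: coprime_dvd_mult_left_iff coprime_commute)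
  then have "t \<le> c1" using pos(1) by (simp add: dvd_imp_le)
  moreover have "c1 \<le> t"
  proof -
    \<comment> \<open>Otherwise \<open>n1 = u c3 - v c2\<close> with \<open>0 < u < c2\<close> and \<open>v > 0\<close>, so \<open>u n2 = t n1 + v n3\<close>
      contradicts the minimality of \<open>c2\<close>.\<close>
    have "\<exists>u v. int n1 = u * int c3 + v * int c2"
    proof -
      obtain p q where "p * int c3 + q * int c2 = 1"
        using cop bezout_int[of "int c3" "int c2"]
        by (auto simp: coprime_iff_gcd_eq_1 gcd.commute)
      then have "int n1 = (int n1 * p) * int c3 + (int n1 * q) * int c2"
        by (metis distrib_left mult.assoc mult.right_neutral)
      then show ?thesis by blast
    qed
    then obtain u0 v0 where n1: "int n1 = u0 * int c3 + v0 * int c2" by blast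
    define w u v where "w = u0 div int c2" and "u = u0 mod int c2" and "v = v0 + w * int c3"
    have "u0 = u + w * int c2" by (simp add: w_def u_def)
    then have "int n1 = (u + w * int c2) * int c3 + v0 * int c2" using n1 by blast
    also have "\<dots> = u * int c3 + v * int c2" by (simp add: v_def algebra_simps)
    finally have uv: "int n1 = u * int c3 + v * int c2" .
    have u: "0 \<le> u" "u < int c2" using pos(2) by (simp_all add: u_def)
    have v: "0 \<le> v"
    proof (rule ccontr)
      assume neg: "\<not> 0 \<le> v"
      have "int (nat u * n2) = int (t * n1 + nat (- v) * n3)"
        using u neg uv by (simp add: t2 t3 algebra_simps)
      then have eq': "nat u * n2 = t * n1 + nat (- v) * n3" by (simp only: of_nat_eq_iff)
      have "0 < nat u" using eq' t n by (cases "nat u = 0") auto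
      from le2[OF this eq'] u show False by simp
    qed
    have "int (t * n1) = int (nat u * n2 + nat v * n3)"
      using u v uv by (simp add: t2 t3 algebra_simps)
    then have "t * n1 = nat u * n2 + nat v * n3" by (simp only: of_nat_eq_iff)
    then show ?thesis using t by (intro le1)
  qed
  ultimately have c1_t: "c1 = t" by simp
  show "0 < c1" by (fact pos(1))
  show "n2 = c1 * c3" "n3 = c1 * c2" using t2 t3 c1_t by simp_all
  show "coprime n1 c1" using cop1 c1_t by simp
  show "c3 < c2" using n(3) t unfolding t2 t3 by simp
  have "c1 * n1 = c1 * (r12 * c3 + r13 * c2)" using rel(1) unfolding t2 t3 c1_t by (simp add: algebra_simps)
  then show "n1 = r12 * c3 + r13 * c2" using pos(1) by simp
qed

context gluing
begin

lemma fraction_ok_iff: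
  assumes "0 < \<epsilon>"
  shows "fraction_ok \<delta>1 \<delta>2 r13 c3 \<epsilon> e \<longleftrightarrow> int \<epsilon> * \<delta>2 < e * \<delta>1 \<and> e * int r13 \<le> int \<epsilon> * int c3"
proof -
  have "real_of_int \<delta>2 / real_of_int \<delta>1 < real_of_int e / real \<epsilon> \<longleftrightarrow>
      real_of_int (int \<epsilon> * \<delta>2) < real_of_int (e * \<delta>1)"
    using assms \<delta>1_pos by (simp add: field_simps)
  moreover have "real_of_int e / real \<epsilon> \<le> real c3 / real r13 \<longleftrightarrow>
      real_of_int (e * int r13) \<le> real_of_int (int \<epsilon> * int c3)"
    using assms r13_pos by (simp add: field_simps)
  ultimately show ?thesis unfolding fraction_ok_def of_int_less_iff of_int_le_iff by simp
qed

text \<open>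
  The least integer \<open>e\<close> with \<open>e / \<epsilon> > \<delta>2 / \<delta>1\<close> is \<open>\<lfloor>\<epsilon> \<delta>2 / \<delta>1\<rfloor> + 1\<close>; it satisfies the upper
  bound because some larger integer does.  The fraction \<open>c3 / r13\<close> shows that \<open>\<epsilon>\<close> exists.
\<close>

lemma epsilon_eta:
  fixes \<epsilon> :: nat and \<eta> :: int
  assumes \<epsilon>: "\<epsilon> = epsilon \<delta>1 \<delta>2 r13 c3" and \<eta>: "\<eta> = eta \<delta>1 \<delta>2 r13 c3"
  shows "0 < \<epsilon>" "int \<epsilon> * \<delta>2 < int (nat \<eta>) * \<delta>1" "nat \<eta> * r13 \<le> \<epsilon> * c3"
    "\<And>\<alpha> \<beta>. 0 < \<beta> \<Longrightarrow> int \<beta> * \<delta>2 < int \<alpha> * \<delta>1 \<Longrightarrow> \<alpha> * r13 \<le> \<beta> * c3 \<Longrightarrow> \<epsilon> \<le> \<beta>"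
    "\<And>\<alpha>. int \<epsilon> * \<delta>2 < int \<alpha> * \<delta>1 \<Longrightarrow> nat \<eta> \<le> \<alpha>"
proof -
  let ?P = "\<lambda>\<epsilon>. 0 < \<epsilon> \<and> (\<exists>e. fraction_ok \<delta>1 \<delta>2 r13 c3 \<epsilon> e)"
  have "fraction_ok \<delta>1 \<delta>2 r13 c3 r13 (int c3)"
    using slope_less by (simp add: fraction_ok_iff[OF r13_pos] mult.commute)
  then have "?P r13" using r13_pos by blast
  then have "?P \<epsilon>" unfolding \<epsilon> epsilon_def by (rule LeastI)
  then obtain e where pos: "0 < \<epsilon>" and "fraction_ok \<delta>1 \<delta>2 r13 c3 \<epsilon> e" by blast
  then have e: "int \<epsilon> * \<delta>2 < e * \<delta>1" "e * int r13 \<le> int \<epsilon> * int c3" by (simp_all add: fraction_ok_iff)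
  show "0 < \<epsilon>" by (fact pos)
  show "\<epsilon> \<le> \<beta>" if "0 < \<beta>" "int \<beta> * \<delta>2 < int \<alpha> * \<delta>1" "\<alpha> * r13 \<le> \<beta> * c3" for \<alpha> \<beta>
  proof -
    have "int (\<alpha> * r13) \<le> int (\<beta> * c3)" using that(3) by (simp only: of_nat_le_iff)
    with that have "?P \<beta>" by (auto simp: fraction_ok_iff intro!: exI[of _ "int \<alpha>"])
    then show ?thesis unfolding \<epsilon> epsilon_def by (rule Least_le)
  qed
  define e0 where "e0 = int \<epsilon> * \<delta>2 div \<delta>1 + 1"
  have above: "int \<epsilon> * \<delta>2 < k * \<delta>1 \<longleftrightarrow> e0 \<le> k" for k
  proof
    assume less: "int \<epsilon> * \<delta>2 < k * \<delta>1"
    have "(int \<epsilon> * \<delta>2 div \<delta>1) * \<delta>1 \<le> int \<epsilon> * \<delta>2"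
      using \<delta>1_pos by (simp add: minus_mod_eq_div_mult[symmetric])
    with less have "(int \<epsilon> * \<delta>2 div \<delta>1) * \<delta>1 < k * \<delta>1" by linarith
    then show "e0 \<le> k" using \<delta>1_pos by (simp add: e0_def)
  next
    assume "e0 \<le> k"
    then have "e0 * \<delta>1 \<le> k * \<delta>1" using \<delta>1_pos by simp
    moreover have "e0 * \<delta>1 = int \<epsilon> * \<delta>2 - int \<epsilon> * \<delta>2 mod \<delta>1 + \<delta>1"
      by (simp add: e0_def distrib_right minus_mod_eq_div_mult[symmetric])
    moreover have "int \<epsilon> * \<delta>2 mod \<delta>1 < \<delta>1" using \<delta>1_pos by simp
    ultimately show "int \<epsilon> * \<delta>2 < k * \<delta>1" by linarith
  qed
  have "e0 \<le> e" using e(1) above by simp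
  then have "e0 * int r13 \<le> e * int r13" by (intro mult_right_mono) auto
  with e(2) have below: "e0 * int r13 \<le> int \<epsilon> * int c3" by linarith
  have "\<eta> = e0"
    unfolding \<eta> eta_def \<epsilon>[symmetric]
  proof (rule Least_equality)
    show "fraction_ok \<delta>1 \<delta>2 r13 c3 \<epsilon> e0" using below above[of e0] by (simp add: fraction_ok_iff[OF pos])
    show "e0 \<le> k" if "fraction_ok \<delta>1 \<delta>2 r13 c3 \<epsilon> k" for k
      using that above by (simp add: fraction_ok_iff[OF pos])
  qed
  moreover have "0 < e0 * \<delta>1" using above[of e0] \<delta>2_pos
    by (meson le_less_trans mult_nonneg_nonneg of_nat_0_le_iff less_imp_le order_refl)
  then have "0 \<le> e0" using \<delta>1_pos by (simp add: zero_less_mult_iff)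
  ultimately have int_\<eta>: "int (nat \<eta>) = e0" by simp
  show "int \<epsilon> * \<delta>2 < int (nat \<eta>) * \<delta>1" unfolding int_\<eta> using above by simp
  show "nat \<eta> \<le> \<alpha>" if "int \<epsilon> * \<delta>2 < int \<alpha> * \<delta>1" for \<alpha> using that above int_\<eta> by (metis of_nat_le_iff)
  have "int (nat \<eta> * r13) \<le> int (\<epsilon> * c3)" using below by (simp only: of_nat_mult int_\<eta>)
  then show "nat \<eta> * r13 \<le> \<epsilon> * c3" by (simp only: of_nat_le_iff)
qed

text \<open>
  The exponents of \<open>h\<close> have equal weight, so \<open>lattice_basis\<close> supplies the coordinates.  They are
  coprime because a common divisor divides \<open>a / d\<close> and \<open>b / d\<close>.
\<close>

lemma h_pair_equations:
  fixes a b d \<alpha>h \<beta>h :: nat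
  assumes a: "a = n2 - n1" and b: "b = n3 - n1" and d: "d = gcd a b"
    and h: "(\<alpha>h, \<beta>h) = h_pair c1 c2 c3 r12 r13 a b"
  shows "0 < \<alpha>h" "0 < \<beta>h" "int \<alpha>h * \<delta>1 = int \<beta>h * \<delta>2" "coprime \<alpha>h \<beta>h"
    "\<alpha>h * c1 = (b - a) div d" "\<alpha>h * r12 + \<beta>h * c2 = b div d" "\<beta>h * c3 - \<alpha>h * r13 = a div d"
proof -
  have n2_n3: "n2 < n3" using c3_less_c2 c1_pos by (simp add: n2_eq n3_eq)
  have ab: "a < b" "0 < a" using n1_less_n2 n2_n3 by (simp_all add: a b)
  have d_pos: "0 < d" using ab d by simp
  define u v where "u = a div d" and "v = b div d"
  have u: "a = d * u" and v: "b = d * v" using d by (simp_all add: u_def v_def)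
  have uv: "u < v" using ab(1) unfolding u v by simp
  have quot: "(b - a) div d = v - u" using d_pos unfolding u v by (simp add: diff_mult_distrib2[symmetric])
  have cop: "coprime u v" unfolding u_def v_def d using ab by (intro div_gcd_coprime) auto
  have w: "weight n1 n2 n3 (v - u, 0, u) = weight n1 n2 n3 (0, v, 0)"
  proof -
    have "int n2 = int n1 + int d * int u" using n1_less_n2 a u by (metis add_diff_inverse_nat less_imp_not_less of_nat_add of_nat_mult)
    moreover have "int n3 = int n1 + int d * int v"
      using n1_less_n2 n2_n3 b v by (metis add_diff_inverse_nat less_trans less_imp_not_less of_nat_add of_nat_mult)
    ultimately have "int (weight n1 n2 n3 (v - u, 0, u)) = int (weight n1 n2 n3 (0, v, 0))"
      using uv by (simp add: of_nat_diff) (simp add: algebra_simps)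
    then show ?thesis by (simp only: of_nat_eq_iff)
  qed
  from lattice_basis[OF w] obtain \<alpha> \<beta> :: int where l:
    "int (v - u) = int 0 + \<alpha> * int c1" "int 0 = int v - \<alpha> * int r12 - \<beta> * int c2"
    "int u = int 0 - \<alpha> * int r13 + \<beta> * int c3"
    "int (mon_deg (v - u, 0, u)) - int (mon_deg (0, v, 0)) = \<alpha> * \<delta>1 - \<beta> * \<delta>2" .
  have slope: "\<alpha> * \<delta>1 = \<beta> * \<delta>2" using l(4) uv by simp
  have "0 < \<alpha> * int c1" using l(1) uv by simp
  then have \<alpha>: "0 < \<alpha>" using c1_pos by (simp add: zero_less_mult_iff)
  have "0 < \<alpha> * \<delta>1" using \<alpha> \<delta>1_pos by simp
  then have \<beta>: "0 < \<beta>" using \<delta>2_pos unfolding slope by (simp add: zero_less_mult_iff)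
  define x y where "x = nat \<alpha>" and "y = nat \<beta>"
  have xy: "\<alpha> = int x" "\<beta> = int y" using \<alpha> \<beta> by (simp_all add: x_def y_def)
  have e1: "x * c1 = v - u"
  proof -
    have "int (x * c1) = int (v - u)" using l(1) by (simp add: xy)
    then show ?thesis by (simp only: of_nat_eq_iff)
  qed
  have e2: "x * r12 + y * c2 = v"
  proof -
    have "int (x * r12 + y * c2) = int v" using l(2) by (simp add: xy)
    then show ?thesis by (simp only: of_nat_eq_iff)
  qed
  have e3: "- int x * int r13 + int y * int c3 = int u" using l(3) by (simp add: xy)
  have "h_pair c1 c2 c3 r12 r13 a b = (x, y)"
    unfolding h_pair_def Let_def d[symmetric] quot u_def[symmetric] v_def[symmetric]
  proof (rule the_equality)
    show "case (x, y) of (\<alpha>, \<beta>) \<Rightarrow> 0 < \<alpha> \<and> 0 < \<beta> \<and> \<alpha> * c1 = v - u \<and> \<alpha> * r12 + \<beta> * c2 = v \<and>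
        - int \<alpha> * int r13 + int \<beta> * int c3 = int u"
      using \<alpha> \<beta> e1 e2 e3 by (simp add: xy)
  next
    fix p assume "case p of (\<alpha>, \<beta>) \<Rightarrow> 0 < \<alpha> \<and> 0 < \<beta> \<and> \<alpha> * c1 = v - u \<and> \<alpha> * r12 + \<beta> * c2 = v \<and>
        - int \<alpha> * int r13 + int \<beta> * int c3 = int u"
    then obtain x' y' where p: "p = (x', y')" "x' * c1 = v - u" "x' * r12 + y' * c2 = v" by auto
    have "x' * c1 = x * c1" using p(2) e1 by simp
    then have x': "x' = x" using c1_pos by simp
    have "y' * c2 = y * c2" using p(3) e2 unfolding x' by linarith
    then have "y' = y" using c3_less_c2 by simp
    with x' p(1) show "p = (x, y)" by simp
  qed
  then have xy_h: "\<alpha>h = x" "\<beta>h = y" using h by simp_all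
  have e3': "y * c3 - x * r13 = u"
  proof -
    have "int (y * c3) = int (u + x * r13)" using e3 by simp
    then have "y * c3 = u + x * r13" by (simp only: of_nat_eq_iff)
    then show ?thesis by simp
  qed
  show "0 < \<alpha>h" "0 < \<beta>h" using \<alpha> \<beta> by (simp_all add: xy xy_h)
  show "int \<alpha>h * \<delta>1 = int \<beta>h * \<delta>2" using slope by (simp add: xy xy_h)
  show "coprime \<alpha>h \<beta>h"
  proof (rule coprimeI)
    fix k assume "k dvd \<alpha>h" "k dvd \<beta>h"
    then have "k dvd u" "k dvd v"
      unfolding e2[symmetric] e3'[symmetric] by (simp_all add: xy_h dvd_diff_nat)
    with cop show "k dvd 1" by (rule coprime_common_divisor)
  qed
  show "\<alpha>h * c1 = (b - a) div d" "\<alpha>h * r12 + \<beta>h * c2 = b div d" "\<beta>h * c3 - \<alpha>h * r13 = a div d"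
    using e1 e2 e3' quot by (simp_all add: xy_h u_def v_def)
qed

end

section \<open>The initial form ideal of the semigroup\<close>

theorem lemma3p7:
  fixes n1 n2 n3 c1 c2 c3 r12 r13 r21 r23 r31 r32 a b d \<epsilon> \<alpha>\<^sub>h \<beta>\<^sub>h :: nat
    and \<delta>1 \<delta>2 \<eta> :: int
    and I Istar P Q :: "'k::field pol3 set"
    and A B :: "(nat \<times> nat) set"
    and g h :: "'k pol3"
  assumes "0 < n1" and "n1 < n2" and "n2 < n3"
    and "Gcd {n1, n2, n3} = 1"
    and "minimally_generates {n1, n2, n3} (semigroup_gen {n1, n2, n3})"
    and "I = semigroup_ideal n1 n2 n3"
    and "Istar = initial_form_ideal I"
    and "a = n2 - n1" and "b = n3 - n1" and "d = gcd a b"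
    and "c1 = least_multiplier n1 {n2, n3}"
    and "c2 = least_multiplier n2 {n1, n3}"
    and "c3 = least_multiplier n3 {n1, n2}"
    and "c1 * n1 = r12 * n2 + r13 * n3"
    and "c2 * n2 = r21 * n1 + r23 * n3"
    and "c3 * n3 = r31 * n1 + r32 * n2"
    and "r21 = 0" and "r31 = 0"
    and "0 < r13" and "r13 < c3"
    and "\<delta>1 = int c1 - (int r12 + int r13)" and "\<delta>2 = int c2 - int c3"
    and "(\<alpha>\<^sub>h, \<beta>\<^sub>h) = h_pair c1 c2 c3 r12 r13 a b"
    and "\<epsilon> = epsilon \<delta>1 \<delta>2 r13 c3" and "\<eta> = eta \<delta>1 \<delta>2 r13 c3"
    and "A = A_set r13 c3 \<epsilon>" and "B = B_set \<delta>1 \<delta>2 r13 c3"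
    and "P = p_mon c2 c3 r12 r13 ` A" and "Q = q_mon c1 c3 r13 ` B"
    and "g = Y ^ (nat \<eta> * r12 + \<epsilon> * c2)"
    and "h = Y ^ (b div d) - X ^ ((b - a) div d) * Z ^ (a div d)"
  shows "Istar = ideal_gen ({g, h} \<union> P \<union> Q) \<and>
    (\<beta>\<^sub>h > \<epsilon> \<longrightarrow> Istar = ideal_gen ({g} \<union> P \<union> Q)) \<and>
    (\<beta>\<^sub>h \<le> \<epsilon> \<longrightarrow>
      Istar = ideal_gen ({h} \<union> p_mon c2 c3 r12 r13 ` {(\<alpha>, \<beta>) \<in> A. \<beta> < \<beta>\<^sub>h} \<union> Q)) \<and>
    (\<forall>M \<subseteq> {g, h} \<union> P \<union> Q. minimal_generating_set M Istar \<longrightarrow> groebner_basis M Istar) \<and>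
    mingen_number Istar \<le> c3 + 2"
proof -
  have rel: "c2 * n2 = r23 * n3" "c3 * n3 = r32 * n2"
    using assms(15-18) by simp_all
  note data = gluing_structure[OF assms(1-4) assms(11-14) rel]
  interpret gluing n1 n2 n3 c1 c2 c3 r12 r13 \<delta>1 \<delta>2
    by unfold_locales (rule data assms(2,19-22))+
  note hp = h_pair_equations[OF assms(8-10,23)]
  interpret gluing_tangent n1 n2 n3 c1 c2 c3 r12 r13 \<delta>1 \<delta>2 \<epsilon> "nat \<eta>" \<alpha>\<^sub>h \<beta>\<^sub>h
    by unfold_locales (rule hp epsilon_eta[OF assms(24,25)]; assumption)+
  have Istar: "Istar = tangent_ideal n1 n2 n3"
    unfolding assms(6,7) by (rule initial_form_ideal_semigroup_ideal)
  have "Y ^ j = (monomial (0, j, 0) :: 'k pol3)" "X ^ i * Z ^ k = (monomial (i, 0, k) :: 'k pol3)" for i j k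
    using monomial_eq[where 'k='k, of 0 j 0] monomial_eq[where 'k='k, of i 0 k] by simp_all
  then have g: "g = monomial g_exp" and h: "h = h_poly"
    unfolding assms(30,31) by (simp_all add: g_exp_def h_poly_def y_exp_def w_exp_def hp(5-7))
  show ?thesis
    unfolding Istar g h assms(26-29)
  proof (intro conjI allI impI)
    show "tangent_ideal n1 n2 n3 = ideal_gen ({monomial g_exp, h_poly} \<union> P_set \<union> (Q_set :: 'k pol3 set))"
      by (rule tangent_ideal_generators)
    show "tangent_ideal n1 n2 n3 = ideal_gen ({monomial g_exp} \<union> P_set \<union> (Q_set :: 'k pol3 set))" if "\<epsilon> < \<beta>\<^sub>h"
      using that by (rule tangent_ideal_generators_monomial)
    show "tangent_ideal n1 n2 n3 = ideal_gen ({h_poly} \<union> P'_set \<union> (Q_set :: 'k pol3 set))" if "\<beta>\<^sub>h \<le> \<epsilon>"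
      using that by (rule tangent_ideal_generators_binomial)
    show "groebner_basis M (tangent_ideal n1 n2 n3)"
      if "M \<subseteq> {monomial g_exp, h_poly} \<union> P_set \<union> Q_set" "minimal_generating_set M (tangent_ideal n1 n2 n3)"
      for M :: "'k pol3 set"
      using that(1) that(2)[unfolded minimal_generating_set_def, THEN conjunct1]
      by (rule groebner_basis_generating_subset)
    show "mingen_number (tangent_ideal n1 n2 n3 :: 'k pol3 set) \<le> c3 + 2"
      by (rule mingen_number_tangent_ideal)
  qed
qed

end
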